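(* Let $\phi:R\rightarrow S$ be a homomorphism of commutative rings and let $\mathscr{F}$ be the set of ideals $I$ of $R$ such that $IS=S$. If $\phi$ is a flat epimorphism then there is a unique isomorphism of rings $\psi:R_{\mathscr{F}}\rightarrow S$ such that $\phi=\psi\circ j_R$.
   Context: All rings are commutative. A flat epimorphism is a ring map that is flat and is an epimorphism in the category of commutative rings. $IS$ denotes the ideal of $S$ generated by $\phi(I)$. The family $\mathscr{F}$ is non-empty, closed under passing to larger ideals and under finite intersections, and satisfies: if $I\in\mathscr{F}$ and $J$ is an ideal with $(J:a)\in\mathscr{F}$ for all $a\in I$ then $J\in\mathscr{F}$ (i.e. it is an idempotent topologizing system), so the following constructions make sense. $\mathscr{F}(R)=\{r\in R:\operatorname{Ann}_R(r)\in\mathscr{F}\}$ (an ideal), and $R_{\mathscr{F}}=\operatorname{colim}_{I\in\mathscr{F}}\operatorname{Hom}_R(I,R/\mathscr{F}(R))$, where $\mathscr{F}$ is directed by reverse inclusion and the transition maps are restrictions; $[f]$ denotes the class of $f:I\to R/\mathscr{F}(R)$. The map $j_R:R\to R_{\mathscr{F}}$ sends $m$ to the class of $R\to R/\mathscr{F}(R)$, $r\mapsto rm+\mathscr{F}(R)$. $R_{\mathscr{F}}$ is a commutative ring: for $f:I\to R/\mathscr{F}(R)$ and $g:J\to R/\mathscr{F}(R)$ $R$-linear with $I,J\in\mathscr{F}$, put $\overline{J}=(J+\mathscr{F}(R))/\mathscr{F}(R)$ and $\overline{g}:\overline{J}\to R/\mathscr{F}(R)$, $b+\mathscr{F}(R)\mapsto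 g(b)$ for $b\in J$; then $f^{-1}(\overline{J})\in\mathscr{F}$ and $[f].[g]=[\overline{g}\circ f|_{f^{-1}(\overline{J})}]$. The unit is the class of the canonical map $R\to R/\mathscr{F}(R)$, and $j_R$ is a ring homomorphism. *)

theory Defs
  imports "HOL-Algebra.Algebra"
begin

section \<open>Modules and tensor products\<close>

definition module_homs ::
    "('r, 'c) ring_scheme \<Rightarrow> ('r, 'm, 'd) module_scheme \<Rightarrow> ('r, 'n, 'e) module_scheme \<Rightarrow> ('m \<Rightarrow> 'n) set"
  where "module_homs R M N =
    {h \<in> carrier M \<rightarrow>\<^sub>E carrier N.
      (\<forall>x\<in>carrier M. \<forall>y\<in>carrier M. h (x \<oplus>\<^bsub>M\<^esub> y) = h x \<oplus>\<^bsub>N\<^esub> h y) \<and>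
      (\<forall>r\<in>carrier R. \<forall>x\<in>carrier M. h (r \<odot>\<^bsub>M\<^esub> x) = r \<odot>\<^bsub>N\<^esub> h x)}"

text \<open>The record \<^typ>\<open>('r, 'm) module\<close> has ring fields \<open>mult\<close> and \<open>one\<close> that the locale
  \<^locale>\<open>module\<close> leaves unconstrained; below they are inherited from the ring at hand and
  play no role.\<close>

definition restrict_scalars ::
    "('r \<Rightarrow> 's) \<Rightarrow> ('s, 'd) ring_scheme \<Rightarrow> ('r, 's) module"
  where "restrict_scalars \<phi> S =
    \<lparr>carrier = carrier S, monoid.mult = monoid.mult S, monoid.one = monoid.one S,
     ring.zero = ring.zero S, ring.add = ring.add S, smult = (\<lambda>r s. \<phi> r \<otimes>\<^bsub>S\<^esub> s)\<rparr>"

definition ideal_module :: "('r, 'c) ring_scheme \<Rightarrow> 'r set \<Rightarrow> ('r, 'r) module"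
  where "ideal_module R I =
    \<lparr>carrier = I, monoid.mult = monoid.mult R, monoid.one = monoid.one R,
     ring.zero = ring.zero R, ring.add = ring.add R, smult = monoid.mult R\<rparr>"

definition quot_module :: "('r, 'c) ring_scheme \<Rightarrow> 'r set \<Rightarrow> ('r, 'r set) module"
  where "quot_module R J = restrict_scalars (\<lambda>r. J +>\<^bsub>R\<^esub> r) (R Quot J)"

definition tensor_relations ::
    "('r, 'c) ring_scheme \<Rightarrow> ('r, 'm, 'd) module_scheme \<Rightarrow> ('r, 'n, 'e) module_scheme \<Rightarrow> ('m \<times> 'n \<Rightarrow>\<^sub>0 int) set"
  where "tensor_relations R M N =
    {frag_of (x \<oplus>\<^bsub>M\<^esub> x', y) - frag_of (x, y) - frag_of (x', y) | x x' y.
        x \<in> carrier M \<and> x' \<in> carrier M \<and> y \<in> carrier N} \<union>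
    {frag_of (x, y \<oplus>\<^bsub>N\<^esub> y') - frag_of (x, y) - frag_of (x, y') | x y y'.
        x \<in> carrier M \<and> y \<in> carrier N \<and> y' \<in> carrier N} \<union>
    {frag_of (r \<odot>\<^bsub>M\<^esub> x, y) - frag_of (x, r \<odot>\<^bsub>N\<^esub> y) | r x y.
        r \<in> carrier R \<and> x \<in> carrier M \<and> y \<in> carrier N}"

definition tensor_kernel ::
    "('r, 'c) ring_scheme \<Rightarrow> ('r, 'm, 'd) module_scheme \<Rightarrow> ('r, 'n, 'e) module_scheme \<Rightarrow> ('m \<times> 'n \<Rightarrow>\<^sub>0 int) set"
  where "tensor_kernel R M N =
    generate (free_Abelian_group (carrier M \<times> carrier N)) (tensor_relations R M N)"

text \<open>Only the additive group of the tensor product is recorded (written multiplicatively, as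
  usual for \<^term>\<open>G Mod H\<close>); this is all that injectivity of induced maps depends on.\<close>

definition tensor ::
    "('r, 'c) ring_scheme \<Rightarrow> ('r, 'm, 'd) module_scheme \<Rightarrow> ('r, 'n, 'e) module_scheme \<Rightarrow> ('m \<times> 'n \<Rightarrow>\<^sub>0 int) set monoid"
  where "tensor R M N =
    free_Abelian_group (carrier M \<times> carrier N) Mod tensor_kernel R M N"

text \<open>The map from \<open>M \<otimes> P\<close> to \<open>N \<otimes> P\<close> induced by \<open>h\<close> from \<open>M\<close> to \<open>N\<close>. It is given on cosets;
  all elements \<open>c\<close> of a coset \<open>A\<close> contribute the same coset, so the union is that coset.\<close>

definition tensor_map ::
    "('r, 'c) ring_scheme \<Rightarrow> ('r, 'n, 'e) module_scheme \<Rightarrow> ('r, 'p, 'f) module_scheme \<Rightarrow>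
      ('m \<Rightarrow> 'n) \<Rightarrow> ('m \<times> 'p \<Rightarrow>\<^sub>0 int) set \<Rightarrow> ('n \<times> 'p \<Rightarrow>\<^sub>0 int) set"
  where "tensor_map R N P h A =
    (\<Union>c\<in>A. tensor_kernel R N P #>\<^bsub>free_Abelian_group (carrier N \<times> carrier P)\<^esub>
              frag_extend (\<lambda>(x, p). frag_of (h x, p)) c)"

section \<open>Flat epimorphisms\<close>

text \<open>A definition cannot quantify over types, so flatness is tested on modules carried by
  subsets of a type \<open>'u\<close> that is passed as an argument. Since injectivity of
  \<open>I \<otimes> P \<rightarrow> R \<otimes> P\<close> for all ideals \<open>I\<close> of \<open>R\<close> already implies flatness, the choice of \<open>'u\<close>
  is immaterial as soon as \<open>'u\<close> contains a copy of \<open>'r\<close>.\<close>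

definition flat_module ::
    "'u itself \<Rightarrow> ('r, 'c) ring_scheme \<Rightarrow> ('r, 'p, 'f) module_scheme \<Rightarrow> bool"
  where "flat_module _ R P \<longleftrightarrow> module R P \<and>
    (\<forall>(M :: ('r, 'u) module) (N :: ('r, 'u) module) h.
      module R M \<longrightarrow> module R N \<longrightarrow> h \<in> module_homs R M N \<longrightarrow> inj_on h (carrier M) \<longrightarrow>
      inj_on (tensor_map R N P h) (carrier (tensor R M P)))"

definition flat_ring_hom ::
    "'u itself \<Rightarrow> ('r, 'c) ring_scheme \<Rightarrow> ('s, 'd) ring_scheme \<Rightarrow> ('r \<Rightarrow> 's) \<Rightarrow> bool"
  where "flat_ring_hom U R S \<phi> \<longleftrightarrow>
    \<phi> \<in> ring_hom R S \<and> flat_module U R (restrict_scalars \<phi> S)"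

text \<open>Likewise, the test rings \<open>T\<close> are carried by subsets of \<open>'t\<close>. If \<open>g\<close> and \<open>h\<close> map
  \<open>S\<close> to an arbitrary ring, the subring generated by their images has cardinality at most that
  of \<open>S\<close> or is countable, so the choice of \<open>'t\<close> is immaterial as soon as \<open>'t\<close> is
  infinite and contains a copy of \<open>'s\<close>.\<close>

definition comm_ring_epi ::
    "'t itself \<Rightarrow> ('r, 'c) ring_scheme \<Rightarrow> ('s, 'd) ring_scheme \<Rightarrow> ('r \<Rightarrow> 's) \<Rightarrow> bool"
  where "comm_ring_epi _ R S \<phi> \<longleftrightarrow> \<phi> \<in> ring_hom R S \<and>
    (\<forall>(T :: 't ring) g h.
      cring T \<longrightarrow> g \<in> ring_hom S T \<longrightarrow> h \<in> ring_hom S T \<longrightarrow>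
      (\<forall>r\<in>carrier R. g (\<phi> r) = h (\<phi> r)) \<longrightarrow> (\<forall>s\<in>carrier S. g s = h s))"

section \<open>The ring of fractions at a family of ideals\<close>

text \<open>In this section \<open>F\<close> is meant to be an idempotent topologizing system of ideals of \<open>R\<close>.\<close>

definition annihilator :: "('r, 'c) ring_scheme \<Rightarrow> 'r \<Rightarrow> 'r set"
  where "annihilator R r = {a \<in> carrier R. a \<otimes>\<^bsub>R\<^esub> r = \<zero>\<^bsub>R\<^esub>}"

definition torsion :: "('r, 'c) ring_scheme \<Rightarrow> 'r set set \<Rightarrow> 'r set"
  where "torsion R F = {r \<in> carrier R. annihilator R r \<in> F}"

definition loc_reps :: "('r, 'c) ring_scheme \<Rightarrow> 'r set set \<Rightarrow> ('r set \<times> ('r \<Rightarrow> 'r set)) set"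
  where "loc_reps R F =
    (SIGMA I:F. module_homs R (ideal_module R I) (quot_module R (torsion R F)))"

text \<open>The equivalence relation presenting the filtered colimit: two homomorphisms are identified
  when they have the same restriction to some smaller ideal in \<open>F\<close>.\<close>

definition loc_rel ::
    "('r, 'c) ring_scheme \<Rightarrow> 'r set set \<Rightarrow> (('r set \<times> ('r \<Rightarrow> 'r set)) \<times> ('r set \<times> ('r \<Rightarrow> 'r set))) set"
  where "loc_rel R F =
    {((I, f), (J, g)). (I, f) \<in> loc_reps R F \<and> (J, g) \<in> loc_reps R F \<and>
      (\<exists>K\<in>F. K \<subseteq> I \<and> K \<subseteq> J \<and> restrict f K = restrict g K)}"

definition loc_class ::
    "('r, 'c) ring_scheme \<Rightarrow> 'r set set \<Rightarrow> 'r set \<Rightarrow> ('r \<Rightarrow> 'r set) \<Rightarrow> ('r set \<times> ('r \<Rightarrow> 'r set)) set"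
  where "loc_class R F I f = loc_rel R F `` {(I, f)}"

definition loc_add_rep ::
    "('r, 'c) ring_scheme \<Rightarrow> 'r set set \<Rightarrow> 'r set \<Rightarrow> ('r \<Rightarrow> 'r set) \<Rightarrow> 'r set \<Rightarrow> ('r \<Rightarrow> 'r set) \<Rightarrow>
      ('r set \<times> ('r \<Rightarrow> 'r set)) set"
  where "loc_add_rep R F I f J g =
    loc_class R F (I \<inter> J) (\<lambda>x\<in>I \<inter> J. f x \<oplus>\<^bsub>R Quot torsion R F\<^esub> g x)"

definition ideal_bar :: "('r, 'c) ring_scheme \<Rightarrow> 'r set set \<Rightarrow> 'r set \<Rightarrow> 'r set set"
  where "ideal_bar R F J = {torsion R F +>\<^bsub>R\<^esub> b | b. b \<in> J <+>\<^bsub>R\<^esub> torsion R F}"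

definition hom_bar ::
    "('r, 'c) ring_scheme \<Rightarrow> 'r set set \<Rightarrow> 'r set \<Rightarrow> ('r \<Rightarrow> 'r set) \<Rightarrow> 'r set \<Rightarrow> 'r set"
  where "hom_bar R F J g A = (THE B. \<exists>b\<in>J. A = torsion R F +>\<^bsub>R\<^esub> b \<and> B = g b)"

definition loc_mult_rep ::
    "('r, 'c) ring_scheme \<Rightarrow> 'r set set \<Rightarrow> 'r set \<Rightarrow> ('r \<Rightarrow> 'r set) \<Rightarrow> 'r set \<Rightarrow> ('r \<Rightarrow> 'r set) \<Rightarrow>
      ('r set \<times> ('r \<Rightarrow> 'r set)) set"
  where "loc_mult_rep R F I f J g =
    (let K = {x \<in> I. f x \<in> ideal_bar R F J}
     in loc_class R F K (\<lambda>x\<in>K. hom_bar R F J g (f x)))"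

text \<open>As is common for quotients, the operations on classes are unions over all
  representatives; all members of the union coincide.\<close>

definition loc_ring ::
    "('r, 'c) ring_scheme \<Rightarrow> 'r set set \<Rightarrow> ('r set \<times> ('r \<Rightarrow> 'r set)) set ring"
  where "loc_ring R F =
    \<lparr>carrier = loc_reps R F // loc_rel R F,
     monoid.mult = (\<lambda>A B. \<Union>(I, f)\<in>A. \<Union>(J, g)\<in>B. loc_mult_rep R F I f J g),
     monoid.one = loc_class R F (carrier R) (\<lambda>r\<in>carrier R. torsion R F +>\<^bsub>R\<^esub> r),
     ring.zero = loc_class R F (carrier R) (\<lambda>r\<in>carrier R. \<zero>\<^bsub>R Quot torsion R F\<^esub>),
     ring.add = (\<lambda>A B. \<Union>(I, f)\<in>A. \<Union>(J, g)\<in>B. loc_add_rep R F I f J g)\<rparr>"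

definition loc_map ::
    "('r, 'c) ring_scheme \<Rightarrow> 'r set set \<Rightarrow> 'r \<Rightarrow> ('r set \<times> ('r \<Rightarrow> 'r set)) set"
  where "loc_map R F m =
    loc_class R F (carrier R) (\<lambda>r\<in>carrier R. torsion R F +>\<^bsub>R\<^esub> (r \<otimes>\<^bsub>R\<^esub> m))"

end

theory Submission
  imports Defs
begin

text \<open>Let \<open>\<phi>\<close> be a flat epimorphism and let \<open>F\<close> be the family of ideals \<open>I\<close> with \<open>I S = S\<close>. Everything
rests on two facts: every \<open>r\<close> with \<open>\<phi> r = 0\<close> has its annihilator in \<open>F\<close>, and for every \<open>s\<close> in
\<open>S\<close> the conductor \<open>{a. \<phi> a s \<in> \<phi>(R)}\<close> is in \<open>F\<close>. So the elements of \<open>S\<close> are fractions of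
elements of \<open>R\<close>, with denominators that become jointly invertible in \<open>S\<close>.

Both facts follow from one principle, \<open>flat_conductor_generates\<close>. Let \<open>P\<close> be a submodule of an
\<open>R\<close>-module \<open>N\<close> and let \<open>x\<close> be an element of \<open>N\<close> such that \<open>x \<otimes> 1 = p \<otimes> t\<close> in \<open>N \<otimes> S\<close> with
\<open>p \<in> P\<close>. By flatness this equation already holds in \<open>M \<otimes> S\<close> for \<open>M = P + R x\<close>. As \<open>M / P\<close> is
\<open>R / J\<close> for the conductor \<open>J = {a. a x \<in> P}\<close>, the image of the equation in
\<open>(M / P) \<otimes> S = S / J S\<close> says \<open>1 \<in> J S\<close>. Taking \<open>N = R\<close>, \<open>P = 0\<close>, \<open>x = r\<close> gives the fact on
annihilators, since \<open>r \<otimes> 1 = 1 \<otimes> \<phi> r = 0\<close>. Taking \<open>N = S\<close>, \<open>P = \<phi>(R)\<close>, \<open>x = s\<close> gives the fact on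
conductors, since \<open>s \<otimes> 1 = 1 \<otimes> s\<close> in \<open>S \<otimes> S\<close> for an epimorphism: the two maps from \<open>S\<close> to the
ring \<open>S \<otimes> S\<close> agree on \<open>R\<close>.

Given these facts, the torsion ideal is the kernel of \<open>\<phi>\<close>, so \<open>R / F(R)\<close> is embedded in \<open>S\<close>. A
homomorphism from \<open>I \<in> F\<close> to \<open>R / F(R)\<close> is then multiplication by a unique element of
\<open>S\<close> (\<open>reps_are_fracs\<close>), and two homomorphisms represent the same element of the colimit if and only
if they belong to the same element of \<open>S\<close> (\<open>loc_class_frac\<close>). The resulting bijection
\<open>frac_class\<close> from \<open>S\<close> to the ring of fractions is compatible with the operations, and the isomorphism
sought is its inverse. It is unique because its value at the class of \<open>s\<close> is determined by its
products with the elements \<open>\<phi> a\<close>, where \<open>a\<close> runs through the conductor of \<open>s\<close>.\<close>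

section \<open>Kernels of tensor products\<close>

lemma hom_generate_into_subgroup:
  assumes "group G" "group H" "h \<in> hom G H" "A \<subseteq> carrier G"
    and "subgroup U H" "h ` A \<subseteq> U" "c \<in> generate G A"
  shows "h c \<in> U"
proof -
  interpret group_hom G H h
    using assms by (simp add: group_hom_def group_hom_axioms_def)
  have "h c \<in> h ` generate G A" using assms by blast
  also have "\<dots> = generate H (h ` A)" using generate_img[OF \<open>A \<subseteq> carrier G\<close>] by simp
  also have "\<dots> \<subseteq> U" using H.generate_subgroup_incl assms by blast
  finally show ?thesis .
qed

lemma keys_frag_of_diff2:
  "x \<in> A \<Longrightarrow> y \<in> A \<Longrightarrow> Poly_Mapping.keys (frag_of x - frag_of y) \<subseteq> A"
  using keys_diff[of "frag_of x" "frag_of y"] by (auto simp: keys_frag_of)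

lemma keys_frag_of_diff3:
  "x \<in> A \<Longrightarrow> y \<in> A \<Longrightarrow> z \<in> A \<Longrightarrow>
    Poly_Mapping.keys (frag_of x - frag_of y - frag_of z) \<subseteq> A"
  using keys_diff[of "frag_of x - frag_of y" "frag_of z"] keys_frag_of_diff2[of x A y]
  by (auto simp: keys_frag_of)

lemma frag_extend_hom_free_Abelian_group:
  assumes "\<And>x. x \<in> A \<Longrightarrow> Poly_Mapping.keys (f x) \<subseteq> B"
  shows "frag_extend f \<in> hom (free_Abelian_group A) (free_Abelian_group B)"
proof (rule homI)
  fix c assume "c \<in> carrier (free_Abelian_group A)"
  then show "frag_extend f c \<in> carrier (free_Abelian_group B)"
    using keys_frag_extend[of f c] assms
    by (auto simp: subset_eq)
qed (simp add: frag_extend_add)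

lemma tensor_relations_cases [consumes 1, case_names addL addR smult]:
  assumes "c \<in> tensor_relations R M N"
  obtains x x' y where "x \<in> carrier M" "x' \<in> carrier M" "y \<in> carrier N"
      "c = frag_of (x \<oplus>\<^bsub>M\<^esub> x', y) - frag_of (x, y) - frag_of (x', y)"
  | x y y' where "x \<in> carrier M" "y \<in> carrier N" "y' \<in> carrier N"
      "c = frag_of (x, y \<oplus>\<^bsub>N\<^esub> y') - frag_of (x, y) - frag_of (x, y')"
  | r x y where "r \<in> carrier R" "x \<in> carrier M" "y \<in> carrier N"
      "c = frag_of (r \<odot>\<^bsub>M\<^esub> x, y) - frag_of (x, r \<odot>\<^bsub>N\<^esub> y)"
  using assms unfolding tensor_relations_def by blast

lemma tensor_relations_subset:
  assumes "module R M" "module R N"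
  shows "tensor_relations R M N \<subseteq> carrier (free_Abelian_group (carrier M \<times> carrier N))"
proof -
  interpret M: module R M by fact
  interpret N: module R N by fact
  show ?thesis
  proof
    fix c assume "c \<in> tensor_relations R M N"
    then show "c \<in> carrier (free_Abelian_group (carrier M \<times> carrier N))"
      by (cases rule: tensor_relations_cases)
        (simp_all add: keys_frag_of_diff2 keys_frag_of_diff3)
  qed
qed

lemma tensor_kernel_subgroup:
  assumes "module R M" "module R N"
  shows "subgroup (tensor_kernel R M N) (free_Abelian_group (carrier M \<times> carrier N))"
  unfolding tensor_kernel_def
  by (intro group.generate_is_subgroup group_free_Abelian_group tensor_relations_subset assms)

lemma tensor_kernel_diff:
  assumes "module R M" "module R N" "c \<in> tensor_kernel R M N" "d \<in> tensor_kernel R M N"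
  shows "c - d \<in> tensor_kernel R M N"
proof -
  interpret K: subgroup "tensor_kernel R M N" "free_Abelian_group (carrier M \<times> carrier N)"
    by (rule tensor_kernel_subgroup) fact+
  show ?thesis
    using K.m_closed[OF assms(3) K.m_inv_closed[OF assms(4)]] K.mem_carrier[OF assms(4)] by simp
qed

text \<open>The universal property of the tensor product: an additive map on formal sums that sends the defining
relations into \<open>U\<close> induces a map from the tensor product to the quotient by \<open>U\<close>.\<close>

lemma tensor_kernel_into_subgroup:
  assumes "module R M" "module R N" "group H"
    and "h \<in> hom (free_Abelian_group (carrier M \<times> carrier N)) H" "subgroup U H"
    and "\<And>c. c \<in> tensor_relations R M N \<Longrightarrow> h c \<in> U"
    and "c \<in> tensor_kernel R M N"
  shows "h c \<in> U"
  using hom_generate_into_subgroup[OF group_free_Abelian_group \<open>group H\<close> assms(4)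
      tensor_relations_subset[OF assms(1,2)] assms(5)] assms(6,7)
  unfolding tensor_kernel_def by blast

lemma tensor_relation_addL:
  "\<lbrakk>x \<in> carrier M; x' \<in> carrier M; y \<in> carrier N\<rbrakk> \<Longrightarrow>
    frag_of (x \<oplus>\<^bsub>M\<^esub> x', y) - frag_of (x, y) - frag_of (x', y) \<in> tensor_relations R M N"
  unfolding tensor_relations_def by blast

lemma tensor_relation_addR:
  "\<lbrakk>x \<in> carrier M; y \<in> carrier N; y' \<in> carrier N\<rbrakk> \<Longrightarrow>
    frag_of (x, y \<oplus>\<^bsub>N\<^esub> y') - frag_of (x, y) - frag_of (x, y') \<in> tensor_relations R M N"
  unfolding tensor_relations_def by blast

lemma tensor_relation_smult:
  "\<lbrakk>r \<in> carrier R; x \<in> carrier M; y \<in> carrier N\<rbrakk> \<Longrightarrow>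
    frag_of (r \<odot>\<^bsub>M\<^esub> x, y) - frag_of (x, r \<odot>\<^bsub>N\<^esub> y) \<in> tensor_relations R M N"
  unfolding tensor_relations_def by blast

lemma tensor_relations_subset_kernel: "tensor_relations R M N \<subseteq> tensor_kernel R M N"
  unfolding tensor_kernel_def by (auto intro: generate.incl)

abbreviation map_left :: "('m \<Rightarrow> 'n) \<Rightarrow> ('m \<times> 'p \<Rightarrow>\<^sub>0 int) \<Rightarrow> ('n \<times> 'p \<Rightarrow>\<^sub>0 int)"
  where "map_left h \<equiv> frag_extend (\<lambda>(x, p). frag_of (h x, p))"

lemma module_homsD:
  assumes "h \<in> module_homs R M N"
  shows "x \<in> carrier M \<Longrightarrow> h x \<in> carrier N"
    and "\<lbrakk>x \<in> carrier M; y \<in> carrier M\<rbrakk> \<Longrightarrow> h (x \<oplus>\<^bsub>M\<^esub> y) = h x \<oplus>\<^bsub>N\<^esub> h y"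
    and "\<lbrakk>r \<in> carrier R; x \<in> carrier M\<rbrakk> \<Longrightarrow> h (r \<odot>\<^bsub>M\<^esub> x) = r \<odot>\<^bsub>N\<^esub> h x"
    and "x \<notin> carrier M \<Longrightarrow> h x = undefined"
  using assms unfolding module_homs_def by auto

lemma map_left_hom:
  assumes "h \<in> module_homs R M N"
  shows "map_left h \<in> hom (free_Abelian_group (carrier M \<times> carrier P))
                          (free_Abelian_group (carrier N \<times> carrier P))"
  by (rule frag_extend_hom_free_Abelian_group)
    (auto simp: keys_frag_of module_homsD[OF assms])

text \<open>A homomorphism \<open>h\<close> carries relations to relations, so \<open>h \<otimes> P\<close> is well defined.\<close>

lemma map_left_tensor_kernel:
  assumes "module R M" "module R N" "module R P" "h \<in> module_homs R M N"
    and "c \<in> tensor_kernel R M P"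
  shows "map_left h c \<in> tensor_kernel R N P"
proof (rule tensor_kernel_into_subgroup[OF assms(1,3) group_free_Abelian_group
        map_left_hom[OF assms(4)] tensor_kernel_subgroup[OF assms(2,3)] _ assms(5)])
  fix c assume "c \<in> tensor_relations R M P"
  then have "map_left h c \<in> tensor_relations R N P"
    by (cases rule: tensor_relations_cases)
      (auto simp: frag_extend_diff module_homsD[OF assms(4)]
        intro!: tensor_relation_addL tensor_relation_addR tensor_relation_smult)
  then show "map_left h c \<in> tensor_kernel R N P"
    using tensor_relations_subset_kernel by blast
qed

text \<open>This turns the union in the definition of \<^const>\<open>tensor_map\<close> into a single coset, so that all
questions about \<open>h \<otimes> P\<close> become questions about formal sums.\<close>

lemma tensor_map_coset:
  assumes "module R M" "module R N" "module R P" "h \<in> module_homs R M N"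
    and "c \<in> carrier (free_Abelian_group (carrier M \<times> carrier P))"
  shows "tensor_map R N P h (tensor_kernel R M P #>\<^bsub>free_Abelian_group (carrier M \<times> carrier P)\<^esub> c)
    = tensor_kernel R N P #>\<^bsub>free_Abelian_group (carrier N \<times> carrier P)\<^esub> map_left h c"
    (is "tensor_map R N P h (?KM #>\<^bsub>?FM\<^esub> c) = ?KN #>\<^bsub>?FN\<^esub> map_left h c")
proof -
  interpret KM: subgroup ?KM ?FM by (rule tensor_kernel_subgroup) fact+
  interpret KN: subgroup ?KN ?FN by (rule tensor_kernel_subgroup) fact+
  have hc: "map_left h c \<in> carrier ?FN"
    using map_left_hom[OF assms(4)] assms(5) unfolding hom_def by blast
  have "?KN #>\<^bsub>?FN\<^esub> map_left h c' = ?KN #>\<^bsub>?FN\<^esub> map_left h c" if c': "c' \<in> ?KM #>\<^bsub>?FM\<^esub> c" for c'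
  proof -
    obtain k where k: "k \<in> ?KM" "c' = k + c"
      using c' by (auto simp: r_coset_def simp del: carrier_free_Abelian_group_iff)
    have "map_left h c' \<in> ?KN #>\<^bsub>?FN\<^esub> map_left h c"
      using map_left_tensor_kernel[OF assms(1-4) k(1)]
      by (auto simp: r_coset_def k(2) frag_extend_add)
    then show ?thesis
      using group.repr_independence[OF group_free_Abelian_group _ hc KN.subgroup_axioms] by simp
  qed
  moreover have "c \<in> ?KM #>\<^bsub>?FM\<^esub> c"
    using group.rcos_self[OF group_free_Abelian_group assms(5) KM.subgroup_axioms] .
  ultimately have "(\<Union>c'\<in>?KM #>\<^bsub>?FM\<^esub> c. ?KN #>\<^bsub>?FN\<^esub> map_left h c') = ?KN #>\<^bsub>?FN\<^esub> map_left h c"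
    by (intro UN_constant_eq ballI)
  then show ?thesis unfolding tensor_map_def .
qed

text \<open>The form in which flatness is used: a formal sum over a submodule that vanishes in the larger tensor
product already vanishes in the smaller one.\<close>

lemma flat_module_reflects_kernel:
  fixes M N :: "('r, 'u) module"
  assumes flat: "flat_module TYPE('u) R P"
    and M: "module R M" and N: "module R N"
    and h: "h \<in> module_homs R M N" "inj_on h (carrier M)"
    and c: "c \<in> carrier (free_Abelian_group (carrier M \<times> carrier P))"
    and hc: "map_left h c \<in> tensor_kernel R N P"
  shows "c \<in> tensor_kernel R M P"
proof -
  let ?FM = "free_Abelian_group (carrier M \<times> carrier P)"
  let ?FN = "free_Abelian_group (carrier N \<times> carrier P)"
  let ?KM = "tensor_kernel R M P" and ?KN = "tensor_kernel R N P"
  have P: "module R P" and inj: "inj_on (tensor_map R N P h) (carrier (tensor R M P))"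
    using flat M N h unfolding flat_module_def by blast+
  interpret KM: subgroup ?KM ?FM by (rule tensor_kernel_subgroup) fact+
  interpret KN: subgroup ?KN ?FN by (rule tensor_kernel_subgroup) fact+
  have 0: "0 \<in> carrier ?FM" by simp
  have cosets: "?KM #>\<^bsub>?FM\<^esub> d \<in> carrier (tensor R M P)" if "d \<in> carrier ?FM" for d
    using that unfolding tensor_def FactGroup_def RCOSETS_def by auto
  have "?KN #>\<^bsub>?FN\<^esub> map_left h c = ?KN #>\<^bsub>?FN\<^esub> map_left h 0"
    using group.coset_join2[OF group_free_Abelian_group _ KN.subgroup_axioms]
      hc KN.one_closed KN.mem_carrier by simp
  then have "tensor_map R N P h (?KM #>\<^bsub>?FM\<^esub> c) = tensor_map R N P h (?KM #>\<^bsub>?FM\<^esub> 0)"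
    by (simp only: tensor_map_coset[OF M N P h(1)] c 0)
  then have "?KM #>\<^bsub>?FM\<^esub> c = ?KM #>\<^bsub>?FM\<^esub> 0"
    by (rule inj_onD[OF inj _ cosets[OF c] cosets[OF 0]])
  also have "\<dots> = ?KM"
    using group.coset_join2[OF group_free_Abelian_group 0 KM.subgroup_axioms] KM.one_closed
    by simp
  finally show ?thesis
    using group.rcos_self[OF group_free_Abelian_group c KM.subgroup_axioms] by simp
qed

section \<open>Conductors along flat ring homomorphisms\<close>

lemma module_restrict_scalars:
  assumes "cring R" "cring S" "\<phi> \<in> ring_hom R S"
  shows "module R (restrict_scalars \<phi> S)"
proof -
  interpret R: cring R by fact
  interpret S: cring S by fact
  note \<phi> = ring_hom_closed[OF assms(3)] ring_hom_add[OF assms(3)] ring_hom_mult[OF assms(3)]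
    ring_hom_one[OF assms(3)]
  have "abelian_group (restrict_scalars \<phi> S)"
  proof (rule abelian_groupI)
    fix x assume "x \<in> carrier (restrict_scalars \<phi> S)"
    then show "\<exists>y\<in>carrier (restrict_scalars \<phi> S).
        y \<oplus>\<^bsub>restrict_scalars \<phi> S\<^esub> x = \<zero>\<^bsub>restrict_scalars \<phi> S\<^esub>"
      using S.l_neg by (auto simp: restrict_scalars_def)
  qed (auto simp: restrict_scalars_def S.a_ac)
  then show ?thesis
    by (intro moduleI \<open>cring R\<close>)
      (auto simp: restrict_scalars_def \<phi> S.l_distr S.r_distr S.m_assoc)
qed

text \<open>Closure under negation comes for free from multiplication by \<open>- 1\<close>; likewise for submodules below.\<close>

lemma (in cring) ideal_of_closed:
  assumes "U \<subseteq> carrier R" "\<zero> \<in> U" "\<And>x y. x \<in> U \<Longrightarrow> y \<in> U \<Longrightarrow> x \<oplus> y \<in> U"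
    and "\<And>x r. x \<in> U \<Longrightarrow> r \<in> carrier R \<Longrightarrow> r \<otimes> x \<in> U"
  shows "ideal U R"
proof (rule idealI[OF ring_axioms])
  show "subgroup U (add_monoid R)"
  proof (rule add.subgroupI)
    fix x assume x: "x \<in> U"
    then have "\<ominus> \<one> \<otimes> x \<in> U" using assms by simp
    then show "\<ominus> x \<in> U" using x assms(1) by (simp add: l_minus subset_iff)
  qed (use assms in auto)
  fix x r assume "x \<in> U" "r \<in> carrier R"
  then show "r \<otimes> x \<in> U" "x \<otimes> r \<in> U"
    using assms(1,4) m_comm[of x r] by auto
qed

lemma (in module) submodule_of_closed:
  assumes "H \<subseteq> carrier M" "\<zero>\<^bsub>M\<^esub> \<in> H" "\<And>x y. x \<in> H \<Longrightarrow> y \<in> H \<Longrightarrow> x \<oplus>\<^bsub>M\<^esub> y \<in> H"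
    and "\<And>r x. r \<in> carrier R \<Longrightarrow> x \<in> H \<Longrightarrow> r \<odot>\<^bsub>M\<^esub> x \<in> H"
  shows "submodule H R M"
proof (rule submoduleI)
  fix x assume x: "x \<in> H"
  then have "(\<ominus> \<one>) \<odot>\<^bsub>M\<^esub> x \<in> H" using assms by simp
  then show "\<ominus>\<^bsub>M\<^esub> x \<in> H" using x assms(1) by (simp add: smult_l_minus subset_iff)
qed (use assms in auto)

lemma (in module) submodule_zero_closed: "submodule H R M \<Longrightarrow> \<zero>\<^bsub>M\<^esub> \<in> H"
  using submodule.axioms(1) subgroup.one_closed by fastforce

lemma (in module) ideal_conductor:
  assumes H: "submodule H R M" and x: "x \<in> carrier M"
  shows "ideal {a \<in> carrier R. a \<odot>\<^bsub>M\<^esub> x \<in> H} R"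
  using submoduleE[OF H] submodule_zero_closed[OF H] x
  by (intro R.ideal_of_closed) (auto simp: smult_l_distr smult_assoc1)

text \<open>The transport of \<open>N\<close> along an injection \<open>e\<close>. Flatness over a type \<open>'u\<close> only speaks of modules
carried by \<open>'u\<close>; this moves \<open>R\<close> and \<open>S\<close> into a common type.\<close>

definition image_module :: "('m \<Rightarrow> 'u) \<Rightarrow> ('r, 'm, 'd) module_scheme \<Rightarrow> ('r, 'u) module"
  where "image_module e N = (let d = inv_into (carrier N) e in
    \<lparr>carrier = e ` carrier N, monoid.mult = (\<lambda>u v. e (d u \<otimes>\<^bsub>N\<^esub> d v)), monoid.one = e \<one>\<^bsub>N\<^esub>,
     ring.zero = e \<zero>\<^bsub>N\<^esub>, ring.add = (\<lambda>u v. e (d u \<oplus>\<^bsub>N\<^esub> d v)), smult = (\<lambda>r u. e (r \<odot>\<^bsub>N\<^esub> d u))\<rparr>)"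

lemma image_module_simps:
  assumes "inj_on e (carrier N)"
  shows "carrier (image_module e N) = e ` carrier N"
    and "\<zero>\<^bsub>image_module e N\<^esub> = e \<zero>\<^bsub>N\<^esub>"
    and "\<lbrakk>x \<in> carrier N; y \<in> carrier N\<rbrakk> \<Longrightarrow> e x \<oplus>\<^bsub>image_module e N\<^esub> e y = e (x \<oplus>\<^bsub>N\<^esub> y)"
    and "x \<in> carrier N \<Longrightarrow> r \<odot>\<^bsub>image_module e N\<^esub> e x = e (r \<odot>\<^bsub>N\<^esub> x)"
  using assms by (simp_all add: image_module_def Let_def)

lemma module_image_module:
  assumes "module R N" "inj_on e (carrier N)"
  shows "module R (image_module e N)"
proof -
  interpret module R N by fact
  note simps = image_module_simps[OF assms(2)]
  have "abelian_group (image_module e N)"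
  proof (rule abelian_groupI)
    fix u assume "u \<in> carrier (image_module e N)"
    then obtain x where x: "x \<in> carrier N" "u = e x" by (auto simp: simps)
    then have "e (\<ominus>\<^bsub>N\<^esub> x) \<oplus>\<^bsub>image_module e N\<^esub> u = \<zero>\<^bsub>image_module e N\<^esub>"
      by (simp add: simps M.l_neg)
    then show "\<exists>v\<in>carrier (image_module e N). v \<oplus>\<^bsub>image_module e N\<^esub> u = \<zero>\<^bsub>image_module e N\<^esub>"
      using x by (auto simp: simps)
  qed (auto simp: simps M.a_ac)
  then show ?thesis
    by (intro moduleI R.is_cring)
      (auto simp: simps smult_l_distr smult_r_distr smult_assoc1)
qed

lemma image_module_hom:
  assumes "module R N" "inj_on e (carrier N)"
  shows "restrict e (carrier N) \<in> module_homs R N (image_module e N)"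
proof -
  interpret module R N by fact
  show ?thesis
    unfolding module_homs_def by (auto simp: image_module_simps[OF assms(2)])
qed

lemma submodule_image_module:
  assumes "module R N" "inj_on e (carrier N)" "submodule P R N"
  shows "submodule (e ` P) R (image_module e N)"
proof -
  interpret N: module R N by fact
  interpret E: module R "image_module e N" by (rule module_image_module) fact+
  note P = N.submoduleE[OF assms(3)]
  note simps = image_module_simps[OF assms(2)]
  have z: "\<zero>\<^bsub>N\<^esub> \<in> P"
    by (rule N.submodule_zero_closed) fact
  show ?thesis
    using P z by (intro E.submodule_of_closed) (auto simp: simps subset_iff)
qed

lemma free_Abelian_group_hom_diff:
  assumes "cring S" "h \<in> hom (free_Abelian_group A) (add_monoid S)"
    and "Poly_Mapping.keys a \<subseteq> A" "Poly_Mapping.keys b \<subseteq> A"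
  shows "h (a - b) = h a \<ominus>\<^bsub>S\<^esub> h b"
proof -
  interpret S: cring S by fact
  interpret group_hom "free_Abelian_group A" "add_monoid S" h
    using assms(2) S.a_group by (simp add: group_hom_def group_hom_axioms_def)
  have "h (a + (- b)) = h a \<oplus>\<^bsub>S\<^esub> h (- b)"
    using hom_mult[of a "- b"] assms(3,4) by simp
  also have "h (- b) = \<ominus>\<^bsub>S\<^esub> h b"
    using hom_inv[of b] assms(4) by (simp add: a_inv_def)
  finally show ?thesis by (simp add: a_minus_def)
qed

text \<open>The image of \<open>x \<otimes> 1 = p \<otimes> t\<close> under \<open>(P + R x) \<otimes> S \<rightarrow> S / J S\<close>, where \<open>J\<close> is the conductor of
\<open>x\<close> into \<open>P\<close>, is the equation \<open>1 = 0\<close>. The map sends \<open>(q + a x) \<otimes> s\<close> to the class of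
\<open>\<phi> a s\<close>. The element \<open>a\<close> is determined by \<open>q + a x\<close> only modulo \<open>J\<close>; a choice \<open>\<beta>\<close> of it gives an
additive map \<open>\<Lambda>\<close> from formal sums to \<open>S\<close> that sends all tensor relations into \<open>J S\<close>.\<close>

lemma flat_conductor_generates:
  fixes N :: "('r, 'u) module"
  assumes R: "cring R" and S: "cring S" and flat: "flat_ring_hom TYPE('u) R S \<phi>"
    and N: "module R N" and P: "submodule P R N"
    and x: "x \<in> carrier N" and p: "p \<in> P" and t: "t \<in> carrier S"
    and xp: "frag_of (x, \<one>\<^bsub>S\<^esub>) - frag_of (p, t) \<in> tensor_kernel R N (restrict_scalars \<phi> S)"
  shows "Idl\<^bsub>S\<^esub> (\<phi> ` {a \<in> carrier R. a \<odot>\<^bsub>N\<^esub> x \<in> P}) = carrier S"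
proof -
  interpret R: cring R by fact
  interpret S: cring S by fact
  interpret N: module R N by fact
  define Q where "Q = restrict_scalars \<phi> S"
  have hom: "\<phi> \<in> ring_hom R S" and flatQ: "flat_module TYPE('u) R Q"
    using flat unfolding flat_ring_hom_def Q_def by auto
  note \<phi> = ring_hom_closed[OF hom] ring_hom_add[OF hom] ring_hom_mult[OF hom] ring_hom_one[OF hom]
  interpret H: ring_hom_cring R S \<phi>
    by (intro ring_hom_cring.intro ring_hom_cring_axioms.intro) fact+
  have Q: "module R Q"
    unfolding Q_def by (rule module_restrict_scalars) fact+
  have Qsimps: "carrier Q = carrier S" "add Q = add S" "\<And>r s. r \<odot>\<^bsub>Q\<^esub> s = \<phi> r \<otimes>\<^bsub>S\<^esub> s"
    by (simp_all add: Q_def restrict_scalars_def)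
  note Pc = N.submoduleE[OF P]
  have P0: "\<zero>\<^bsub>N\<^esub> \<in> P"
    by (rule N.submodule_zero_closed) fact
  have PN: "y \<in> P \<Longrightarrow> y \<in> carrier N" for y using Pc(1) by blast
  define J where "J = {a \<in> carrier R. a \<odot>\<^bsub>N\<^esub> x \<in> P}"
  define I where "I = Idl\<^bsub>S\<^esub> (\<phi> ` J)"
  have JS: "\<phi> ` J \<subseteq> carrier S" by (auto simp: J_def \<phi>)
  interpret I: ideal I S unfolding I_def by (rule S.genideal_ideal[OF JS])
  have JI: "a \<in> J \<Longrightarrow> \<phi> a \<in> I" for a
    using S.genideal_self[OF JS] unfolding I_def by blast
  define C where "C = {q \<oplus>\<^bsub>N\<^esub> a \<odot>\<^bsub>N\<^esub> x | q a. q \<in> P \<and> a \<in> carrier R}"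
  define M where "M = N\<lparr>carrier := C\<rparr>"
  have CI: "q \<in> P \<Longrightarrow> a \<in> carrier R \<Longrightarrow> q \<oplus>\<^bsub>N\<^esub> a \<odot>\<^bsub>N\<^esub> x \<in> C" for q a
    by (auto simp: C_def)
  have add_C: "(q \<oplus>\<^bsub>N\<^esub> a \<odot>\<^bsub>N\<^esub> x) \<oplus>\<^bsub>N\<^esub> (q' \<oplus>\<^bsub>N\<^esub> a' \<odot>\<^bsub>N\<^esub> x) = (q \<oplus>\<^bsub>N\<^esub> q') \<oplus>\<^bsub>N\<^esub> (a \<oplus>\<^bsub>R\<^esub> a') \<odot>\<^bsub>N\<^esub> x"
    if "q \<in> P" "q' \<in> P" "a \<in> carrier R" "a' \<in> carrier R" for q q' a a'
    using that x by (simp add: PN N.smult_l_distr N.M.a_ac)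
  have smult_C: "r \<odot>\<^bsub>N\<^esub> (q \<oplus>\<^bsub>N\<^esub> a \<odot>\<^bsub>N\<^esub> x) = r \<odot>\<^bsub>N\<^esub> q \<oplus>\<^bsub>N\<^esub> (r \<otimes>\<^bsub>R\<^esub> a) \<odot>\<^bsub>N\<^esub> x"
    if "q \<in> P" "a \<in> carrier R" "r \<in> carrier R" for q a r
    using that x by (simp add: PN N.smult_r_distr N.smult_assoc1)
  have pC: "q \<in> C" "q = q \<oplus>\<^bsub>N\<^esub> \<zero>\<^bsub>R\<^esub> \<odot>\<^bsub>N\<^esub> x" if "q \<in> P" for q
  proof -
    show "q = q \<oplus>\<^bsub>N\<^esub> \<zero>\<^bsub>R\<^esub> \<odot>\<^bsub>N\<^esub> x" using that x by (simp add: PN)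
    then show "q \<in> C" using CI[OF that R.zero_closed] by simp
  qed
  have xC: "x \<in> C" "x = \<zero>\<^bsub>N\<^esub> \<oplus>\<^bsub>N\<^esub> \<one>\<^bsub>R\<^esub> \<odot>\<^bsub>N\<^esub> x"
  proof -
    show "x = \<zero>\<^bsub>N\<^esub> \<oplus>\<^bsub>N\<^esub> \<one>\<^bsub>R\<^esub> \<odot>\<^bsub>N\<^esub> x" using x by simp
    then show "x \<in> C" using CI[OF P0 R.one_closed] by simp
  qed
  have smult_in_C: "r \<odot>\<^bsub>N\<^esub> y \<in> C" if "r \<in> carrier R" "y \<in> C" for r y
  proof -
    obtain q a where "q \<in> P" "a \<in> carrier R" "y = q \<oplus>\<^bsub>N\<^esub> a \<odot>\<^bsub>N\<^esub> x"
      using \<open>y \<in> C\<close> by (auto simp: C_def)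
    then show ?thesis using CI that(1) Pc(4) by (simp add: smult_C)
  qed
  have CN: "C \<subseteq> carrier N" using x by (auto simp: C_def PN)
  have "submodule C R N"
  proof (rule N.submodule_of_closed)
    show "\<zero>\<^bsub>N\<^esub> \<in> C" by (rule pC(1)[OF P0])
    show "y \<oplus>\<^bsub>N\<^esub> y' \<in> C" if yy: "y \<in> C" "y' \<in> C" for y y'
    proof -
      obtain q a q' a' where "q \<in> P" "a \<in> carrier R" "y = q \<oplus>\<^bsub>N\<^esub> a \<odot>\<^bsub>N\<^esub> x"
        "q' \<in> P" "a' \<in> carrier R" "y' = q' \<oplus>\<^bsub>N\<^esub> a' \<odot>\<^bsub>N\<^esub> x"
        using yy by (auto simp: C_def)
      then show ?thesis using CI Pc(5) by (simp add: add_C)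
    qed
  qed (use CN smult_in_C in auto)
  then have M: "module R M"
    unfolding M_def using submodule.submodule_is_module[OF _ N] by blast
  have Msimps: "carrier M = C" "add M = add N" "\<And>r y. r \<odot>\<^bsub>M\<^esub> y = r \<odot>\<^bsub>N\<^esub> y"
    by (simp_all add: M_def)
  define h where "h = (\<lambda>y\<in>C. y)"
  have h: "h \<in> module_homs R M N"
    using CN N.submoduleE(5)[OF \<open>submodule C R N\<close>]
    by (auto simp: module_homs_def Msimps h_def smult_in_C)
  have hc: "map_left h (frag_of (x, \<one>\<^bsub>S\<^esub>) - frag_of (p, t)) \<in> tensor_kernel R N Q"
    using xp xC(1) pC(1)[OF p] by (simp add: frag_extend_diff h_def Q_def)
  have c_M: "frag_of (x, \<one>\<^bsub>S\<^esub>) - frag_of (p, t) \<in> tensor_kernel R M Q"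
  proof (rule flat_module_reflects_kernel[OF flatQ M N h _ _ hc])
    show "inj_on h (carrier M)" by (auto simp: h_def Msimps inj_on_def)
    show "frag_of (x, \<one>\<^bsub>S\<^esub>) - frag_of (p, t) \<in> carrier (free_Abelian_group (carrier M \<times> carrier Q))"
      using xC(1) pC(1)[OF p] t by (simp add: keys_frag_of_diff2 Msimps Qsimps)
  qed
  \<comment> \<open>\<open>\<beta> y\<close> is a coefficient of \<open>x\<close> in \<open>y \<in> P + R x\<close>, unique only modulo \<open>J\<close>.\<close>
  define \<beta> where "\<beta> y = (SOME a. a \<in> carrier R \<and> (\<exists>q\<in>P. y = q \<oplus>\<^bsub>N\<^esub> a \<odot>\<^bsub>N\<^esub> x))" for y
  have \<beta>: "\<beta> y \<in> carrier R \<and> (\<exists>q\<in>P. y = q \<oplus>\<^bsub>N\<^esub> \<beta> y \<odot>\<^bsub>N\<^esub> x)" if "y \<in> C" for y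
  proof -
    have "\<exists>a. a \<in> carrier R \<and> (\<exists>q\<in>P. y = q \<oplus>\<^bsub>N\<^esub> a \<odot>\<^bsub>N\<^esub> x)" using that by (auto simp: C_def)
    then show ?thesis unfolding \<beta>_def by (rule someI_ex)
  qed
  have \<phi>\<beta>S: "\<phi> (\<beta> y) \<in> carrier S" if "y \<in> C" for y using \<beta>[OF that] \<phi> by blast
  have \<beta>_mod: "\<phi> (\<beta> (q \<oplus>\<^bsub>N\<^esub> a \<odot>\<^bsub>N\<^esub> x)) \<ominus>\<^bsub>S\<^esub> \<phi> a \<in> I" if q: "q \<in> P" and a: "a \<in> carrier R" for q a
  proof -
    define b where "b = \<beta> (q \<oplus>\<^bsub>N\<^esub> a \<odot>\<^bsub>N\<^esub> x)"
    obtain q' where b: "b \<in> carrier R" and q': "q' \<in> P" "q \<oplus>\<^bsub>N\<^esub> a \<odot>\<^bsub>N\<^esub> x = q' \<oplus>\<^bsub>N\<^esub> b \<odot>\<^bsub>N\<^esub> x"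
      using \<beta>[OF CI[OF q a]] unfolding b_def by blast
    have cl: "q \<in> carrier N" "q' \<in> carrier N" "a \<odot>\<^bsub>N\<^esub> x \<in> carrier N" "b \<odot>\<^bsub>N\<^esub> x \<in> carrier N"
      using q q' a b x by (auto simp: PN)
    have "(b \<ominus>\<^bsub>R\<^esub> a) \<odot>\<^bsub>N\<^esub> x = b \<odot>\<^bsub>N\<^esub> x \<oplus>\<^bsub>N\<^esub> \<ominus>\<^bsub>N\<^esub> (a \<odot>\<^bsub>N\<^esub> x)"
      using a b x by (simp add: a_minus_def N.smult_l_distr N.smult_l_minus)
    also have "\<dots> = (\<ominus>\<^bsub>N\<^esub> q' \<oplus>\<^bsub>N\<^esub> (q' \<oplus>\<^bsub>N\<^esub> b \<odot>\<^bsub>N\<^esub> x)) \<oplus>\<^bsub>N\<^esub> \<ominus>\<^bsub>N\<^esub> (a \<odot>\<^bsub>N\<^esub> x)"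
      using cl by (simp add: N.r_neg1)
    also have "\<dots> = \<ominus>\<^bsub>N\<^esub> q' \<oplus>\<^bsub>N\<^esub> q"
      unfolding q'(2)[symmetric] using cl by (simp add: N.M.a_assoc N.r_neg)
    finally have "(b \<ominus>\<^bsub>R\<^esub> a) \<odot>\<^bsub>N\<^esub> x \<in> P" using q q' Pc by simp
    then have "\<phi> (b \<ominus>\<^bsub>R\<^esub> a) \<in> I" using a b by (intro JI) (simp add: J_def)
    moreover have "\<phi> (b \<ominus>\<^bsub>R\<^esub> a) = \<phi> b \<ominus>\<^bsub>S\<^esub> \<phi> a"
      using a b by (simp add: a_minus_def)
    ultimately show ?thesis unfolding b_def by simp
  qed
  obtain \<Lambda> where \<Lambda>: "\<Lambda> \<in> hom (free_Abelian_group (C \<times> carrier S)) (add_monoid S)"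
    "\<And>z. z \<in> C \<times> carrier S \<Longrightarrow> \<Lambda> (frag_of z) = (\<lambda>(y, s). \<phi> (\<beta> y) \<otimes>\<^bsub>S\<^esub> s) z"
  proof (rule comm_group.free_Abelian_group_universal[OF S.a_comm_group])
    show "(\<lambda>(y, s). \<phi> (\<beta> y) \<otimes>\<^bsub>S\<^esub> s) ` (C \<times> carrier S) \<subseteq> carrier (add_monoid S)"
      using \<phi>\<beta>S by auto
  qed blast
  note \<Lambda>_diff = free_Abelian_group_hom_diff[OF S \<Lambda>(1)]
  \<comment> \<open>The identities by which \<open>\<Lambda>\<close> of the three kinds of tensor relations, and at the end \<open>1\<close>, are recognised
    as elements of \<open>I\<close>.\<close>
  have alg:
    "u \<otimes>\<^bsub>S\<^esub> s \<ominus>\<^bsub>S\<^esub> v \<otimes>\<^bsub>S\<^esub> s \<ominus>\<^bsub>S\<^esub> w \<otimes>\<^bsub>S\<^esub> s = (u \<ominus>\<^bsub>S\<^esub> (v \<oplus>\<^bsub>S\<^esub> w)) \<otimes>\<^bsub>S\<^esub> s"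
    "u \<otimes>\<^bsub>S\<^esub> (s \<oplus>\<^bsub>S\<^esub> v) \<ominus>\<^bsub>S\<^esub> u \<otimes>\<^bsub>S\<^esub> s \<ominus>\<^bsub>S\<^esub> u \<otimes>\<^bsub>S\<^esub> v = \<zero>\<^bsub>S\<^esub>"
    "u \<otimes>\<^bsub>S\<^esub> s \<ominus>\<^bsub>S\<^esub> v \<otimes>\<^bsub>S\<^esub> (w \<otimes>\<^bsub>S\<^esub> s) = (u \<ominus>\<^bsub>S\<^esub> w \<otimes>\<^bsub>S\<^esub> v) \<otimes>\<^bsub>S\<^esub> s"
    "\<one>\<^bsub>S\<^esub> = (u \<ominus>\<^bsub>S\<^esub> v \<otimes>\<^bsub>S\<^esub> s) \<ominus>\<^bsub>S\<^esub> (u \<ominus>\<^bsub>S\<^esub> \<one>\<^bsub>S\<^esub>) \<oplus>\<^bsub>S\<^esub> (v \<ominus>\<^bsub>S\<^esub> \<zero>\<^bsub>S\<^esub>) \<otimes>\<^bsub>S\<^esub> s"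
    if "u \<in> carrier S" "v \<in> carrier S" "w \<in> carrier S" "s \<in> carrier S" for u v w s
    using that by algebra+
  have "\<Lambda> (frag_of (x, \<one>\<^bsub>S\<^esub>) - frag_of (p, t)) \<in> I"
  proof (rule tensor_kernel_into_subgroup[OF M Q S.a_group _ I.a_subgroup _ c_M])
    show "\<Lambda> \<in> hom (free_Abelian_group (carrier M \<times> carrier Q)) (add_monoid S)"
      using \<Lambda>(1) by (simp add: Msimps Qsimps)
    fix c assume "c \<in> tensor_relations R M Q"
    then show "\<Lambda> c \<in> I"
    proof (cases rule: tensor_relations_cases)
      case (addL y y' s)
      then have y: "y \<in> C" "y' \<in> C" "s \<in> carrier S" by (auto simp: Msimps Qsimps)
      obtain q q' where q: "q \<in> P" "y = q \<oplus>\<^bsub>N\<^esub> \<beta> y \<odot>\<^bsub>N\<^esub> x" "q' \<in> P" "y' = q' \<oplus>\<^bsub>N\<^esub> \<beta> y' \<odot>\<^bsub>N\<^esub> x"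
        "\<beta> y \<in> carrier R" "\<beta> y' \<in> carrier R"
        using \<beta> y by meson
      have sum: "y \<oplus>\<^bsub>N\<^esub> y' = (q \<oplus>\<^bsub>N\<^esub> q') \<oplus>\<^bsub>N\<^esub> (\<beta> y \<oplus>\<^bsub>R\<^esub> \<beta> y') \<odot>\<^bsub>N\<^esub> x"
        using add_C[OF q(1,3,5,6)] q(2,4) by simp
      have yy: "y \<oplus>\<^bsub>N\<^esub> y' \<in> C" unfolding sum using CI q Pc by simp
      have "\<phi> (\<beta> (y \<oplus>\<^bsub>N\<^esub> y')) \<ominus>\<^bsub>S\<^esub> \<phi> (\<beta> y \<oplus>\<^bsub>R\<^esub> \<beta> y') \<in> I"
        unfolding sum using q Pc(5) by (intro \<beta>_mod) simp_all
      then have "(\<phi> (\<beta> (y \<oplus>\<^bsub>N\<^esub> y')) \<ominus>\<^bsub>S\<^esub> \<phi> (\<beta> y \<oplus>\<^bsub>R\<^esub> \<beta> y')) \<otimes>\<^bsub>S\<^esub> s \<in> I"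
        using y(3) by (rule I.I_r_closed)
      moreover have "\<Lambda> c = (\<phi> (\<beta> (y \<oplus>\<^bsub>N\<^esub> y')) \<ominus>\<^bsub>S\<^esub> \<phi> (\<beta> y \<oplus>\<^bsub>R\<^esub> \<beta> y')) \<otimes>\<^bsub>S\<^esub> s"
        using y yy \<phi>\<beta>S[OF y(1)] \<phi>\<beta>S[OF y(2)] \<phi>\<beta>S[OF yy] q(5,6)
        by (simp add: addL(4) Msimps Qsimps \<Lambda>_diff keys_frag_of keys_frag_of_diff2 \<Lambda>(2) \<phi>(2) alg(1))
      ultimately show ?thesis by simp
    next
      case (addR y s s')
      then have y: "y \<in> C" "s \<in> carrier S" "s' \<in> carrier S" by (auto simp: Msimps Qsimps)
      then have "\<Lambda> c = \<zero>\<^bsub>S\<^esub>"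
        using \<phi>\<beta>S[OF y(1)]
        by (simp add: addR(4) Msimps Qsimps \<Lambda>_diff keys_frag_of keys_frag_of_diff2 \<Lambda>(2) alg(2))
      then show ?thesis by simp
    next
      case (smult r y s)
      then have y: "y \<in> C" "r \<in> carrier R" "s \<in> carrier S" by (auto simp: Msimps Qsimps)
      obtain q where q: "q \<in> P" "y = q \<oplus>\<^bsub>N\<^esub> \<beta> y \<odot>\<^bsub>N\<^esub> x" "\<beta> y \<in> carrier R"
        using \<beta> y by meson
      have ry: "r \<odot>\<^bsub>N\<^esub> y = r \<odot>\<^bsub>N\<^esub> q \<oplus>\<^bsub>N\<^esub> (r \<otimes>\<^bsub>R\<^esub> \<beta> y) \<odot>\<^bsub>N\<^esub> x"
        using smult_C[OF q(1,3) y(2)] q(2) by simp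
      have yy: "r \<odot>\<^bsub>N\<^esub> y \<in> C" using smult_in_C y by simp
      have "\<phi> (\<beta> (r \<odot>\<^bsub>N\<^esub> y)) \<ominus>\<^bsub>S\<^esub> \<phi> (r \<otimes>\<^bsub>R\<^esub> \<beta> y) \<in> I"
        unfolding ry using q Pc(4) y by (intro \<beta>_mod) simp_all
      then have "(\<phi> (\<beta> (r \<odot>\<^bsub>N\<^esub> y)) \<ominus>\<^bsub>S\<^esub> \<phi> (r \<otimes>\<^bsub>R\<^esub> \<beta> y)) \<otimes>\<^bsub>S\<^esub> s \<in> I"
        using y(3) by (rule I.I_r_closed)
      moreover have "\<Lambda> c = (\<phi> (\<beta> (r \<odot>\<^bsub>N\<^esub> y)) \<ominus>\<^bsub>S\<^esub> \<phi> (r \<otimes>\<^bsub>R\<^esub> \<beta> y)) \<otimes>\<^bsub>S\<^esub> s"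
        using y yy \<phi>\<beta>S[OF y(1)] \<phi>\<beta>S[OF yy] q(3) \<phi>(1)[OF y(2)]
        by (simp add: smult(4) Msimps Qsimps \<Lambda>_diff keys_frag_of \<Lambda>(2) \<phi>(3) alg(3))
      ultimately show ?thesis by simp
    qed
  qed
  then have *: "\<phi> (\<beta> x) \<ominus>\<^bsub>S\<^esub> \<phi> (\<beta> p) \<otimes>\<^bsub>S\<^esub> t \<in> I"
    using \<phi>\<beta>S[OF xC(1)] xC(1) pC(1)[OF p] t by (simp add: \<Lambda>_diff keys_frag_of \<Lambda>(2))
  \<comment> \<open>\<open>x = 0 + 1 x\<close> and \<open>p = p + 0 x\<close>, so \<open>\<beta> x\<close> is congruent to \<open>1\<close> and \<open>\<beta> p\<close> to \<open>0\<close>.\<close>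
  have "\<phi> (\<beta> x) \<ominus>\<^bsub>S\<^esub> \<one>\<^bsub>S\<^esub> \<in> I"
    using \<beta>_mod[OF P0 R.one_closed] xC(2) by (simp add: \<phi>)
  moreover have "(\<phi> (\<beta> p) \<ominus>\<^bsub>S\<^esub> \<phi> \<zero>\<^bsub>R\<^esub>) \<otimes>\<^bsub>S\<^esub> t \<in> I"
    using \<beta>_mod[OF p R.zero_closed] pC(2)[OF p] t by (intro I.I_r_closed) simp_all
  moreover have "\<one>\<^bsub>S\<^esub> = (\<phi> (\<beta> x) \<ominus>\<^bsub>S\<^esub> \<phi> (\<beta> p) \<otimes>\<^bsub>S\<^esub> t) \<ominus>\<^bsub>S\<^esub> (\<phi> (\<beta> x) \<ominus>\<^bsub>S\<^esub> \<one>\<^bsub>S\<^esub>)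
      \<oplus>\<^bsub>S\<^esub> (\<phi> (\<beta> p) \<ominus>\<^bsub>S\<^esub> \<phi> \<zero>\<^bsub>R\<^esub>) \<otimes>\<^bsub>S\<^esub> t"
    using alg(4)[OF \<phi>\<beta>S[OF xC(1)] \<phi>\<beta>S[OF pC(1)[OF p]] t t] by simp
  ultimately have "\<one>\<^bsub>S\<^esub> \<in> I" using * by (metis I.a_closed I.a_inv_closed a_minus_def)
  then show ?thesis using I.one_imp_carrier unfolding I_def J_def by simp
qed

text \<open>The same for modules carried by any type that embeds into \<open>'u\<close>.\<close>

lemma flat_conductor_generates_inj:
  fixes N :: "('r, 'n, 'd) module_scheme" and e :: "'n \<Rightarrow> 'u"
  assumes R: "cring R" and S: "cring S" and flat: "flat_ring_hom TYPE('u) R S \<phi>"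
    and e: "inj_on e (carrier N)"
    and N: "module R N" and P: "submodule P R N"
    and x: "x \<in> carrier N" and p: "p \<in> P" and t: "t \<in> carrier S"
    and xp: "frag_of (x, \<one>\<^bsub>S\<^esub>) - frag_of (p, t) \<in> tensor_kernel R N (restrict_scalars \<phi> S)"
  shows "Idl\<^bsub>S\<^esub> (\<phi> ` {a \<in> carrier R. a \<odot>\<^bsub>N\<^esub> x \<in> P}) = carrier S"
proof -
  interpret N: module R N by fact
  have hom: "\<phi> \<in> ring_hom R S" using flat unfolding flat_ring_hom_def by auto
  have PN: "P \<subseteq> carrier N" using N.submoduleE[OF P] by blast
  let ?E = "image_module e N"
  have "map_left (restrict e (carrier N)) (frag_of (x, \<one>\<^bsub>S\<^esub>) - frag_of (p, t))
      \<in> tensor_kernel R ?E (restrict_scalars \<phi> S)"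
    by (rule map_left_tensor_kernel[OF N module_image_module[OF N e]
          module_restrict_scalars[OF R S hom] image_module_hom[OF N e] xp])
  then have "frag_of (e x, \<one>\<^bsub>S\<^esub>) - frag_of (e p, t) \<in> tensor_kernel R ?E (restrict_scalars \<phi> S)"
    using x p PN by (simp add: frag_extend_diff subset_iff)
  then have "Idl\<^bsub>S\<^esub> (\<phi> ` {a \<in> carrier R. a \<odot>\<^bsub>?E\<^esub> e x \<in> e ` P}) = carrier S"
    using x p t e by (intro flat_conductor_generates[OF R S flat module_image_module[OF N e]
          submodule_image_module[OF N e P]]) (auto simp: image_module_simps)
  moreover have "a \<odot>\<^bsub>?E\<^esub> e x \<in> e ` P \<longleftrightarrow> a \<odot>\<^bsub>N\<^esub> x \<in> P" if "a \<in> carrier R" for a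
    using x that PN inj_on_image_mem_iff[OF e _ PN] by (simp add: image_module_simps[OF e])
  ultimately show ?thesis by (simp cong: conj_cong)
qed

section \<open>Epimorphisms and the tensor square\<close>

text \<open>The monoid algebra of \<open>G\<close> over the integers. For \<open>G = S \<times>\<times> S\<close> it is the free group of formal sums
from which \<open>S \<otimes> S\<close> is built, now with the product of \<open>S \<otimes> S\<close> lifted to formal sums.\<close>

definition monoid_ring :: "('g, 'm) monoid_scheme \<Rightarrow> ('g \<Rightarrow>\<^sub>0 int) ring"
  where "monoid_ring G =
    \<lparr>carrier = {c. Poly_Mapping.keys c \<subseteq> carrier G},
     monoid.mult = (\<lambda>c d. frag_extend (\<lambda>x. frag_extend (\<lambda>y. frag_of (x \<otimes>\<^bsub>G\<^esub> y)) d) c),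
     monoid.one = frag_of \<one>\<^bsub>G\<^esub>, ring.zero = 0, ring.add = (+)\<rparr>"

lemma monoid_ring_simps:
  "c \<in> carrier (monoid_ring G) \<longleftrightarrow> Poly_Mapping.keys c \<subseteq> carrier G"
  "\<one>\<^bsub>monoid_ring G\<^esub> = frag_of \<one>\<^bsub>G\<^esub>" "\<zero>\<^bsub>monoid_ring G\<^esub> = 0" "c \<oplus>\<^bsub>monoid_ring G\<^esub> d = c + d"
  "frag_of x \<otimes>\<^bsub>monoid_ring G\<^esub> d = frag_extend (\<lambda>y. frag_of (x \<otimes>\<^bsub>G\<^esub> y)) d"
  "0 \<otimes>\<^bsub>monoid_ring G\<^esub> d = 0" "c \<otimes>\<^bsub>monoid_ring G\<^esub> 0 = 0"
  by (auto simp: monoid_ring_def frag_extend_eq_0)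

lemma monoid_ring_add_monoid: "add_monoid (monoid_ring G) = free_Abelian_group (carrier G)"
  by (simp add: monoid_ring_def free_Abelian_group_def)

lemma frag_extend_diff_fun:
  "frag_extend (\<lambda>x. f x - g x) c = frag_extend f c - frag_extend g c"
  using subset_UNIV by (induction c rule: frag_induction) (simp_all add: frag_extend_diff)

lemma monoid_ring_mult_diff:
  "(a - b) \<otimes>\<^bsub>monoid_ring G\<^esub> d = a \<otimes>\<^bsub>monoid_ring G\<^esub> d - b \<otimes>\<^bsub>monoid_ring G\<^esub> d"
  "d \<otimes>\<^bsub>monoid_ring G\<^esub> (a - b) = d \<otimes>\<^bsub>monoid_ring G\<^esub> a - d \<otimes>\<^bsub>monoid_ring G\<^esub> b"
  by (simp_all add: monoid_ring_def frag_extend_diff frag_extend_diff_fun)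

lemma monoid_ring_mult_add:
  "(a + b) \<otimes>\<^bsub>monoid_ring G\<^esub> d = a \<otimes>\<^bsub>monoid_ring G\<^esub> d + b \<otimes>\<^bsub>monoid_ring G\<^esub> d"
proof -
  have "a + b = a - (0 - b)" by simp
  then have "(a + b) \<otimes>\<^bsub>monoid_ring G\<^esub> d
      = a \<otimes>\<^bsub>monoid_ring G\<^esub> d - (0 - b \<otimes>\<^bsub>monoid_ring G\<^esub> d)"
    by (simp only: monoid_ring_mult_diff monoid_ring_simps)
  then show ?thesis by simp
qed

lemma monoid_ring_a_inv:
  "c \<in> carrier (monoid_ring G) \<Longrightarrow> \<ominus>\<^bsub>monoid_ring G\<^esub> c = - c"
  unfolding a_inv_def monoid_ring_add_monoid by (simp add: monoid_ring_simps)

lemma cring_monoid_ring: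
  assumes "comm_monoid G"
  shows "cring (monoid_ring G)"
proof -
  interpret G: comm_monoid G by fact
  let ?Z = "monoid_ring G"
  have "comm_group (add_monoid ?Z)"
    unfolding monoid_ring_add_monoid by (rule abelian_free_Abelian_group)
  then have "abelian_group ?Z" by (rule comm_group_abelian_groupI)
  moreover have closed: "c \<otimes>\<^bsub>?Z\<^esub> d \<in> carrier ?Z" if "c \<in> carrier ?Z" "d \<in> carrier ?Z" for c d
  proof -
    have "Poly_Mapping.keys d \<subseteq> carrier G" "Poly_Mapping.keys c \<subseteq> carrier G"
      using that by (simp_all add: monoid_ring_simps)
    then show ?thesis
    proof (induction d rule: frag_induction)
      case (one y)
      from one(2) show ?case
      proof (induction c rule: frag_induction)
        case (diff a b)
        then show ?case using keys_diff[of "a \<otimes>\<^bsub>?Z\<^esub> frag_of y" "b \<otimes>\<^bsub>?Z\<^esub> frag_of y"]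
          by (auto simp: monoid_ring_mult_diff monoid_ring_simps(1))
      qed (use one in \<open>auto simp: monoid_ring_simps keys_frag_of\<close>)
    next
      case (diff a b)
      then show ?case using keys_diff[of "c \<otimes>\<^bsub>?Z\<^esub> a" "c \<otimes>\<^bsub>?Z\<^esub> b"]
        by (auto simp: monoid_ring_mult_diff monoid_ring_simps(1))
    qed (simp add: monoid_ring_simps)
  qed
  moreover have comm: "c \<otimes>\<^bsub>?Z\<^esub> d = d \<otimes>\<^bsub>?Z\<^esub> c" if "c \<in> carrier ?Z" "d \<in> carrier ?Z" for c d
  proof -
    have "Poly_Mapping.keys d \<subseteq> carrier G" "Poly_Mapping.keys c \<subseteq> carrier G"
      using that by (simp_all add: monoid_ring_simps)
    then show ?thesis
    proof (induction d rule: frag_induction)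
      case (one y)
      from one(2) show ?case
        by (induction c rule: frag_induction)
          (use one(1) in \<open>simp_all add: monoid_ring_simps monoid_ring_mult_diff G.m_comm\<close>)
    qed (simp_all add: monoid_ring_simps monoid_ring_mult_diff)
  qed
  moreover have "c \<otimes>\<^bsub>?Z\<^esub> d \<otimes>\<^bsub>?Z\<^esub> e = c \<otimes>\<^bsub>?Z\<^esub> (d \<otimes>\<^bsub>?Z\<^esub> e)"
    if "c \<in> carrier ?Z" "d \<in> carrier ?Z" "e \<in> carrier ?Z" for c d e
  proof -
    have "Poly_Mapping.keys c \<subseteq> carrier G" "Poly_Mapping.keys d \<subseteq> carrier G"
      "Poly_Mapping.keys e \<subseteq> carrier G"
      using that by (simp_all add: monoid_ring_simps)
    then show ?thesis
    proof (induction c rule: frag_induction)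
      case (one x)
      from one(2,3) show ?case
      proof (induction d rule: frag_induction)
        case (one y)
        from one(2) show ?case
          by (induction e rule: frag_induction)
            (use \<open>x \<in> carrier G\<close> \<open>y \<in> carrier G\<close> in
              \<open>simp_all add: monoid_ring_simps monoid_ring_mult_diff G.m_assoc frag_extend_diff\<close>)
      qed (simp_all add: monoid_ring_simps(6,7) monoid_ring_mult_diff)
    qed (simp_all add: monoid_ring_simps monoid_ring_mult_diff)
  qed
  moreover have "\<one>\<^bsub>?Z\<^esub> \<otimes>\<^bsub>?Z\<^esub> c = c" if "c \<in> carrier ?Z" for c
  proof -
    have "Poly_Mapping.keys c \<subseteq> carrier G" using that by (simp add: monoid_ring_simps)
    then show ?thesis
      by (induction c rule: frag_induction) (simp_all add: monoid_ring_simps frag_extend_diff)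
  qed
  moreover have "\<one>\<^bsub>?Z\<^esub> \<in> carrier ?Z" by (simp add: monoid_ring_simps keys_frag_of)
  ultimately show ?thesis
    by (intro cringI comm_monoidI) (simp_all add: monoid_ring_mult_add monoid_ring_simps(4))
qed

lemma comm_monoid_DirProd:
  assumes "comm_monoid G" "comm_monoid H"
  shows "comm_monoid (G \<times>\<times> H)"
proof -
  interpret G: comm_monoid G by fact
  interpret H: comm_monoid H by fact
  show ?thesis
    by (rule comm_monoidI) (auto simp: G.m_assoc H.m_assoc intro: G.m_comm H.m_comm)
qed

text \<open>Multiplying a tensor relation by a generator \<open>s \<otimes> t\<close> gives another tensor relation; hence
\<open>S \<otimes> S\<close> inherits a ring structure as a quotient of the monoid algebra.\<close>

lemma ideal_tensor_kernel:
  assumes R: "cring R" and S: "cring S" and hom: "\<phi> \<in> ring_hom R S"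
  shows "ideal (tensor_kernel R (restrict_scalars \<phi> S) (restrict_scalars \<phi> S))
    (monoid_ring (S \<times>\<times> S))"
proof -
  interpret S: cring S by fact
  define Q where "Q = restrict_scalars \<phi> S"
  have Q: "module R Q"
    unfolding Q_def by (rule module_restrict_scalars) fact+
  have Qsimps: "carrier Q = carrier S" "add Q = add S" "\<And>r s. r \<odot>\<^bsub>Q\<^esub> s = \<phi> r \<otimes>\<^bsub>S\<^esub> s"
    by (simp_all add: Q_def restrict_scalars_def)
  let ?Z = "monoid_ring (S \<times>\<times> S)" and ?K = "tensor_kernel R Q Q"
  let ?A = "free_Abelian_group (carrier S \<times> carrier S)"
  have "comm_monoid S" by unfold_locales
  then interpret Z: cring ?Z
    by (intro cring_monoid_ring comm_monoid_DirProd)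
  have add_Z: "add_monoid ?Z = ?A" by (simp only: monoid_ring_add_monoid carrier_DirProd)
  have K: "subgroup ?K ?A"
    using tensor_kernel_subgroup[OF Q Q] by (simp add: Qsimps)
  have frag_of_mult: "frag_of u \<otimes>\<^bsub>?Z\<^esub> k \<in> ?K" if u: "u \<in> carrier S \<times> carrier S" and k: "k \<in> ?K" for u k
  proof (rule tensor_kernel_into_subgroup[OF Q Q group_free_Abelian_group _ K _ k])
    obtain s t where st: "u = (s, t)" "s \<in> carrier S" "t \<in> carrier S" using u by auto
    show "(\<lambda>c. frag_of u \<otimes>\<^bsub>?Z\<^esub> c) \<in> hom (free_Abelian_group (carrier Q \<times> carrier Q)) ?A"
      unfolding monoid_ring_simps Qsimps
      by (rule frag_extend_hom_free_Abelian_group) (auto simp: st keys_frag_of)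
    fix c assume "c \<in> tensor_relations R Q Q"
    then have "frag_of u \<otimes>\<^bsub>?Z\<^esub> c \<in> tensor_relations R Q Q"
    proof (cases rule: tensor_relations_cases)
      case (addL x x' y)
      then show ?thesis
        using tensor_relation_addL[of "s \<otimes>\<^bsub>S\<^esub> x" Q "s \<otimes>\<^bsub>S\<^esub> x'" "t \<otimes>\<^bsub>S\<^esub> y" Q R]
        by (simp add: monoid_ring_mult_diff monoid_ring_simps Qsimps st S.r_distr)
    next
      case (addR x y y')
      then show ?thesis
        using tensor_relation_addR[of "s \<otimes>\<^bsub>S\<^esub> x" Q "t \<otimes>\<^bsub>S\<^esub> y" Q "t \<otimes>\<^bsub>S\<^esub> y'" R]
        by (simp add: monoid_ring_mult_diff monoid_ring_simps Qsimps st S.r_distr)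
    next
      case (smult r x y)
      then show ?thesis
        using tensor_relation_smult[of r R "s \<otimes>\<^bsub>S\<^esub> x" Q "t \<otimes>\<^bsub>S\<^esub> y" Q] ring_hom_closed[OF hom]
        by (simp add: monoid_ring_mult_diff monoid_ring_simps Qsimps st S.m_lcomm)
    qed
    then show "frag_of u \<otimes>\<^bsub>?Z\<^esub> c \<in> ?K"
      using tensor_relations_subset_kernel by blast
  qed
  have mult: "c \<otimes>\<^bsub>?Z\<^esub> k \<in> ?K" if c: "c \<in> carrier ?Z" and k: "k \<in> ?K" for c k
  proof -
    interpret K: additive_subgroup ?K ?Z
      using K by (simp only: additive_subgroup_def add_Z)
    have "Poly_Mapping.keys c \<subseteq> carrier S \<times> carrier S"
      using c by (simp add: monoid_ring_simps)
    then show ?thesis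
    proof (induction c rule: frag_induction)
      case (diff a b)
      have "b \<otimes>\<^bsub>?Z\<^esub> k \<in> carrier ?Z" using diff(2) K.a_subset by blast
      then have "\<ominus>\<^bsub>?Z\<^esub> (b \<otimes>\<^bsub>?Z\<^esub> k) = - (b \<otimes>\<^bsub>?Z\<^esub> k)"
        by (rule monoid_ring_a_inv)
      then have "(a - b) \<otimes>\<^bsub>?Z\<^esub> k = a \<otimes>\<^bsub>?Z\<^esub> k \<oplus>\<^bsub>?Z\<^esub> \<ominus>\<^bsub>?Z\<^esub> (b \<otimes>\<^bsub>?Z\<^esub> k)"
        by (simp add: monoid_ring_mult_diff monoid_ring_simps(4))
      then show ?case using diff K.a_closed K.a_inv_closed by simp
    next
      case zero
      then show ?case using K.zero_closed by (simp add: monoid_ring_simps)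
    qed (use frag_of_mult k in blast)
  qed
  show ?thesis
    unfolding Q_def[symmetric]
  proof (rule idealI[OF Z.ring_axioms])
    show "subgroup ?K (add_monoid ?Z)" using K by (simp only: add_Z)
    then have sub: "?K \<subseteq> carrier ?Z" using subgroup.subset by force
    fix k c assume "k \<in> ?K" "c \<in> carrier ?Z"
    then show "c \<otimes>\<^bsub>?Z\<^esub> k \<in> ?K" "k \<otimes>\<^bsub>?Z\<^esub> c \<in> ?K"
      using mult sub Z.m_comm[of k c] by auto
  qed
qed

text \<open>The maps \<open>s \<mapsto> s \<otimes> 1\<close> and \<open>s \<mapsto> 1 \<otimes> s\<close> are ring homomorphisms to \<open>S \<otimes> S\<close> that agree on the
image of \<open>R\<close>, because \<open>r \<otimes> 1 = 1 \<otimes> r\<close> over \<open>R\<close>.\<close>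

lemma epi_imp_tensor_symmetric:
  assumes R: "cring R" and S: "cring S"
    and epi: "comm_ring_epi TYPE(('s \<times> 's \<Rightarrow>\<^sub>0 int) set) R (S :: ('s, 'd) ring_scheme) \<phi>"
    and s: "s \<in> carrier S"
  shows "frag_of (s, \<one>\<^bsub>S\<^esub>) - frag_of (\<one>\<^bsub>S\<^esub>, s)
    \<in> tensor_kernel R (restrict_scalars \<phi> S) (restrict_scalars \<phi> S)"
proof -
  interpret R: cring R by fact
  interpret S: cring S by fact
  have hom: "\<phi> \<in> ring_hom R S" using epi unfolding comm_ring_epi_def by blast
  define Q where "Q = restrict_scalars \<phi> S"
  have Qsimps: "carrier Q = carrier S" "add Q = add S" "\<And>r s. r \<odot>\<^bsub>Q\<^esub> s = \<phi> r \<otimes>\<^bsub>S\<^esub> s"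
    by (simp_all add: Q_def restrict_scalars_def)
  let ?Z = "monoid_ring (S \<times>\<times> S)" and ?K = "tensor_kernel R Q Q"
  have "comm_monoid S" by unfold_locales
  then interpret Z: cring ?Z
    by (intro cring_monoid_ring comm_monoid_DirProd)
  interpret K: ideal ?K ?Z
    unfolding Q_def by (rule ideal_tensor_kernel) fact+
  have frag_closed: "frag_of (x, y) \<in> carrier ?Z" if "x \<in> carrier S" "y \<in> carrier S" for x y
    using that by (simp add: monoid_ring_simps keys_frag_of)
  have minus: "a - b = a \<ominus>\<^bsub>?Z\<^esub> b" if "b \<in> carrier ?Z" for a b
    using that by (simp add: a_minus_def monoid_ring_a_inv monoid_ring_simps(4))
  have coset_eq: "?K +>\<^bsub>?Z\<^esub> a = ?K +>\<^bsub>?Z\<^esub> b \<longleftrightarrow> a - b \<in> ?K"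
    if "a \<in> carrier ?Z" "b \<in> carrier ?Z" for a b
    using Z.quotient_eq_iff_same_a_r_cos[OF K.is_ideal that] minus[OF that(2)] by simp
  have rel: "c \<in> tensor_relations R Q Q \<Longrightarrow> c \<in> ?K" for c
    using tensor_relations_subset_kernel by blast
  let ?T = "?Z Quot ?K"
  have T: "cring ?T" by (rule K.quotient_is_cring[OF Z.is_cring])
  note Khom = K.rcos_ring_hom
  define g where "g = (\<lambda>s. ?K +>\<^bsub>?Z\<^esub> frag_of (s, \<one>\<^bsub>S\<^esub>))"
  define h where "h = (\<lambda>s. ?K +>\<^bsub>?Z\<^esub> frag_of (\<one>\<^bsub>S\<^esub>, s))"
  have g: "g \<in> ring_hom S ?T"
  proof (rule ring_hom_memI)
    fix x y assume xy: "x \<in> carrier S" "y \<in> carrier S"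
    show "g (x \<otimes>\<^bsub>S\<^esub> y) = g x \<otimes>\<^bsub>?T\<^esub> g y"
      using xy ring_hom_mult[OF Khom frag_closed frag_closed, of x "\<one>\<^bsub>S\<^esub>" y "\<one>\<^bsub>S\<^esub>"]
      by (simp add: g_def monoid_ring_simps)
    have "?K +>\<^bsub>?Z\<^esub> frag_of (x \<oplus>\<^bsub>S\<^esub> y, \<one>\<^bsub>S\<^esub>) = ?K +>\<^bsub>?Z\<^esub> (frag_of (x, \<one>\<^bsub>S\<^esub>) \<oplus>\<^bsub>?Z\<^esub> frag_of (y, \<one>\<^bsub>S\<^esub>))"
      using xy rel[OF tensor_relation_addL[of x Q y "\<one>\<^bsub>S\<^esub>" Q R]]
        Z.a_closed[OF frag_closed frag_closed, of x "\<one>\<^bsub>S\<^esub>" y "\<one>\<^bsub>S\<^esub>"]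
      by (subst coset_eq) (simp_all add: frag_closed Qsimps monoid_ring_simps(4) diff_diff_eq)
    then show "g (x \<oplus>\<^bsub>S\<^esub> y) = g x \<oplus>\<^bsub>?T\<^esub> g y"
      using xy ring_hom_add[OF Khom frag_closed frag_closed, of x "\<one>\<^bsub>S\<^esub>" y "\<one>\<^bsub>S\<^esub>"]
      by (simp add: g_def)
  qed (use ring_hom_closed[OF Khom frag_closed] ring_hom_one[OF Khom] in
      \<open>simp_all add: g_def monoid_ring_simps\<close>)
  have h: "h \<in> ring_hom S ?T"
  proof (rule ring_hom_memI)
    fix x y assume xy: "x \<in> carrier S" "y \<in> carrier S"
    show "h (x \<otimes>\<^bsub>S\<^esub> y) = h x \<otimes>\<^bsub>?T\<^esub> h y"
      using xy ring_hom_mult[OF Khom frag_closed frag_closed, of "\<one>\<^bsub>S\<^esub>" x "\<one>\<^bsub>S\<^esub>" y]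
      by (simp add: h_def monoid_ring_simps)
    have "?K +>\<^bsub>?Z\<^esub> frag_of (\<one>\<^bsub>S\<^esub>, x \<oplus>\<^bsub>S\<^esub> y) = ?K +>\<^bsub>?Z\<^esub> (frag_of (\<one>\<^bsub>S\<^esub>, x) \<oplus>\<^bsub>?Z\<^esub> frag_of (\<one>\<^bsub>S\<^esub>, y))"
      using xy rel[OF tensor_relation_addR[of "\<one>\<^bsub>S\<^esub>" Q x Q y R]]
        Z.a_closed[OF frag_closed frag_closed, of "\<one>\<^bsub>S\<^esub>" x "\<one>\<^bsub>S\<^esub>" y]
      by (subst coset_eq) (simp_all add: frag_closed Qsimps monoid_ring_simps(4) diff_diff_eq)
    then show "h (x \<oplus>\<^bsub>S\<^esub> y) = h x \<oplus>\<^bsub>?T\<^esub> h y"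
      using xy ring_hom_add[OF Khom frag_closed frag_closed, of "\<one>\<^bsub>S\<^esub>" x "\<one>\<^bsub>S\<^esub>" y]
      by (simp add: h_def)
  qed (use ring_hom_closed[OF Khom frag_closed] ring_hom_one[OF Khom] in
      \<open>simp_all add: h_def monoid_ring_simps\<close>)
  have "g (\<phi> r) = h (\<phi> r)" if "r \<in> carrier R" for r
    using that rel[OF tensor_relation_smult[of r R "\<one>\<^bsub>S\<^esub>" Q "\<one>\<^bsub>S\<^esub>" Q]] ring_hom_closed[OF hom that]
    by (simp add: g_def h_def coset_eq frag_closed Qsimps)
  then have "g s = h s"
    using epi T g h s unfolding comm_ring_epi_def by blast
  then show ?thesis
    unfolding Q_def[symmetric] using s by (simp add: g_def h_def coset_eq frag_closed)
qed

section \<open>The ring of fractions\<close>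

text \<open>The two properties of flat epimorphisms that make \<open>S\<close> the ring of fractions of \<open>R\<close> at \<open>F\<close>: elements
of the kernel are torsion, and elements of \<open>S\<close> are fractions.\<close>

locale ideal_localization = ring_hom_cring R S \<phi> for R (structure) and S (structure) and \<phi> +
  fixes F
  assumes F_def: "F = {I. ideal I R \<and> Idl\<^bsub>S\<^esub> (\<phi> ` I) = carrier S}"
    and annihilator_in_F: "\<lbrakk>r \<in> carrier R; \<phi> r = \<zero>\<^bsub>S\<^esub>\<rbrakk> \<Longrightarrow> annihilator R r \<in> F"
    and conductor_in_F: "s \<in> carrier S \<Longrightarrow> {a \<in> carrier R. \<phi> a \<otimes>\<^bsub>S\<^esub> s \<in> \<phi> ` carrier R} \<in> F"
begin

lemma F_ideal: "I \<in> F \<Longrightarrow> ideal I R"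
  by (simp add: F_def)

lemma F_subset: "I \<in> F \<Longrightarrow> I \<subseteq> carrier R"
  using F_ideal ideal.axioms(1) additive_subgroup.a_subset by blast

text \<open>The condition \<open>I S = S\<close> enters through this lemma. To prove a statement about \<open>1 \<in> S\<close>, let
\<open>U\<close> be the set of all elements of \<open>S\<close> for which it holds, and check that \<open>U\<close> is an ideal that
contains \<open>\<phi>(I)\<close>. This avoids writing \<open>1\<close> as a finite combination of elements of \<open>\<phi>(I)\<close>.\<close>

lemma ideal_containing_F_member:
  assumes "I \<in> F" "ideal U S" "\<phi> ` I \<subseteq> U"
  shows "U = carrier S"
  using S.genideal_minimal[OF assms(2,3)] assms(1)
    additive_subgroup.a_subset[OF ideal.axioms(1)[OF assms(2)]]
  by (auto simp: F_def)

lemma F_carrier: "carrier R \<in> F"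
proof -
  have sub: "\<phi> ` carrier R \<subseteq> carrier S" by auto
  have "\<phi> \<one> \<in> Idl\<^bsub>S\<^esub> (\<phi> ` carrier R)" using S.genideal_self[OF sub] by blast
  then show ?thesis
    using ideal.one_imp_carrier[OF S.genideal_ideal[OF sub]] R.oneideal by (simp add: F_def)
qed

lemma F_cancel:
  assumes I: "I \<in> F" and uv: "u \<in> carrier S" "v \<in> carrier S"
    and eq: "\<And>a. a \<in> I \<Longrightarrow> \<phi> a \<otimes>\<^bsub>S\<^esub> u = \<phi> a \<otimes>\<^bsub>S\<^esub> v"
  shows "u = v"
proof -
  have "{w \<in> carrier S. w \<otimes>\<^bsub>S\<^esub> u = w \<otimes>\<^bsub>S\<^esub> v} = carrier S"
  proof (rule ideal_containing_F_member[OF I])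
    show "ideal {w \<in> carrier S. w \<otimes>\<^bsub>S\<^esub> u = w \<otimes>\<^bsub>S\<^esub> v} S"
      using uv by (intro S.ideal_of_closed) (auto simp: S.l_distr S.m_assoc)
    show "\<phi> ` I \<subseteq> {w \<in> carrier S. w \<otimes>\<^bsub>S\<^esub> u = w \<otimes>\<^bsub>S\<^esub> v}"
      using eq F_subset[OF I] by auto
  qed
  then have "\<one>\<^bsub>S\<^esub> \<in> {w \<in> carrier S. w \<otimes>\<^bsub>S\<^esub> u = w \<otimes>\<^bsub>S\<^esub> v}" by simp
  then show ?thesis using uv by simp
qed

text \<open>The identity \<open>(I J) S = S\<close> without forming the product ideal. It serves for the domains of both
sums (\<open>K = I \<inter> J\<close>) and products of homomorphisms.\<close>

lemma F_product:
  assumes I: "I \<in> F" and J: "J \<in> F" and K: "ideal K R"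
    and prod: "\<And>x y. x \<in> I \<Longrightarrow> y \<in> J \<Longrightarrow> x \<otimes> y \<in> K"
  shows "K \<in> F"
proof -
  have sub: "\<phi> ` K \<subseteq> carrier S"
    using additive_subgroup.a_subset[OF ideal.axioms(1)[OF K]] by auto
  define G where "G = Idl\<^bsub>S\<^esub> (\<phi> ` K)"
  interpret G: ideal G S unfolding G_def by (rule S.genideal_ideal[OF sub])
  have KG: "a \<in> K \<Longrightarrow> \<phi> a \<in> G" for a
    using S.genideal_self[OF sub] unfolding G_def by blast
  define U where "U = {u \<in> carrier S. \<forall>y\<in>J. u \<otimes>\<^bsub>S\<^esub> \<phi> y \<in> G}"
  have JS: "y \<in> J \<Longrightarrow> \<phi> y \<in> carrier S" for y using F_subset[OF J] by auto
  have "U = carrier S"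
  proof (rule ideal_containing_F_member[OF I])
    show "ideal U S"
      using JS G.I_l_closed by (intro S.ideal_of_closed) (auto simp: U_def S.l_distr S.m_assoc)
    show "\<phi> ` I \<subseteq> U"
      using prod KG F_subset[OF I] F_subset[OF J]
      by (auto simp: U_def hom_mult[symmetric] subset_iff simp del: hom_mult)
  qed
  then have "\<one>\<^bsub>S\<^esub> \<in> U" by simp
  then have "\<phi> ` J \<subseteq> G" using JS by (auto simp: U_def)
  then have "G = carrier S" by (rule ideal_containing_F_member[OF J G.is_ideal])
  then show ?thesis using K by (simp add: F_def G_def)
qed

lemma F_Int: "I \<in> F \<Longrightarrow> J \<in> F \<Longrightarrow> I \<inter> J \<in> F"
  using F_product[of I J "I \<inter> J"] R.i_intersect[OF F_ideal F_ideal, of I J] F_subset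
    ideal.I_r_closed[OF F_ideal] ideal.I_l_closed[OF F_ideal]
  by (simp add: subset_iff)

text \<open>The elements of \<open>R / F(R)\<close> are exactly the fibres of \<open>\<phi>\<close> over its image, which makes
\<open>v \<mapsto> fibre v\<close> the inverse of the embedding of \<open>R / F(R)\<close> in \<open>S\<close>.\<close>

definition fibre :: "'c \<Rightarrow> 'a set"
  where "fibre v = {b \<in> carrier R. \<phi> b = v}"

lemma fibre_eq_iff: "v \<in> \<phi> ` carrier R \<Longrightarrow> fibre v = fibre w \<longleftrightarrow> v = w"
  by (auto simp: fibre_def)

lemma torsion_eq_kernel: "torsion R F = a_kernel R S \<phi>"
proof -
  have "\<phi> r = \<zero>\<^bsub>S\<^esub>" if r: "r \<in> carrier R" "annihilator R r \<in> F" for r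
  proof (rule F_cancel[OF r(2)])
    fix a assume "a \<in> annihilator R r"
    then have "\<phi> (a \<otimes> r) = \<zero>\<^bsub>S\<^esub>" "a \<in> carrier R" by (auto simp: annihilator_def)
    then show "\<phi> a \<otimes>\<^bsub>S\<^esub> \<phi> r = \<phi> a \<otimes>\<^bsub>S\<^esub> \<zero>\<^bsub>S\<^esub>" using r by simp
  qed (use r in auto)
  then show ?thesis
    unfolding torsion_def a_kernel_def' using annihilator_in_F by blast
qed

abbreviation T where "T \<equiv> torsion R F"

lemma ring_hom_ring: "ring_hom_ring R S \<phi>"
  by (rule ring_hom_ringI2) (auto intro: R.ring_axioms S.ring_axioms)

lemma ideal_torsion: "ideal T R"
  unfolding torsion_eq_kernel by (rule ring_hom_ring.kernel_is_ideal[OF ring_hom_ring])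

sublocale T: ideal T R by (rule ideal_torsion)

lemma torsion_coset: "r \<in> carrier R \<Longrightarrow> T +> r = fibre (\<phi> r)"
  unfolding torsion_eq_kernel fibre_def by (rule ring_hom_ring.rcos_eq_homeq[OF ring_hom_ring])

lemma carrier_quot: "carrier (R Quot T) = fibre ` \<phi> ` carrier R"
  unfolding FactRing_simps by (auto simp: torsion_coset image_iff)

lemma fibre_add:
  assumes "v \<in> \<phi> ` carrier R" "w \<in> \<phi> ` carrier R"
  shows "fibre v \<oplus>\<^bsub>R Quot T\<^esub> fibre w = fibre (v \<oplus>\<^bsub>S\<^esub> w)"
proof -
  obtain a b where "a \<in> carrier R" "b \<in> carrier R" "v = \<phi> a" "w = \<phi> b" using assms by auto
  then show ?thesis
    using T.a_rcos_sum[of a b] by (simp add: FactRing_def torsion_coset)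
qed

lemma fibre_smult:
  assumes "r \<in> carrier R" "v \<in> \<phi> ` carrier R"
  shows "r \<odot>\<^bsub>quot_module R T\<^esub> fibre v = fibre (\<phi> r \<otimes>\<^bsub>S\<^esub> v)"
proof -
  obtain a where "a \<in> carrier R" "v = \<phi> a" using assms by auto
  then show ?thesis
    using T.rcoset_mult_add[of r a] assms(1)
    by (simp add: quot_module_def restrict_scalars_def FactRing_def torsion_coset)
qed

text \<open>Multiplication by \<open>s\<close>, as a map to \<open>R / F(R)\<close>. The next definition says when it takes values in
\<open>R / F(R)\<close>; otherwise some of the fibres are empty.\<close>

definition frac :: "'a set \<Rightarrow> 'c \<Rightarrow> 'a \<Rightarrow> 'a set"
  where "frac I s = (\<lambda>a\<in>I. fibre (\<phi> a \<otimes>\<^bsub>S\<^esub> s))"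

definition admissible :: "'a set \<Rightarrow> 'c \<Rightarrow> bool"
  where "admissible I s \<longleftrightarrow> I \<in> F \<and> s \<in> carrier S \<and> (\<forall>a\<in>I. \<phi> a \<otimes>\<^bsub>S\<^esub> s \<in> \<phi> ` carrier R)"

lemma admissibleD:
  assumes "admissible I s"
  shows "I \<in> F" "s \<in> carrier S" "a \<in> I \<Longrightarrow> \<phi> a \<otimes>\<^bsub>S\<^esub> s \<in> \<phi> ` carrier R"
    "a \<in> I \<Longrightarrow> a \<in> carrier R"
  using assms F_subset by (auto simp: admissible_def)

lemma admissible_conductor:
  "s \<in> carrier S \<Longrightarrow> admissible {a \<in> carrier R. \<phi> a \<otimes>\<^bsub>S\<^esub> s \<in> \<phi> ` carrier R} s"
  using conductor_in_F by (simp add: admissible_def)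

lemma admissible_image: "r \<in> carrier R \<Longrightarrow> admissible (carrier R) (\<phi> r)"
  by (auto simp: admissible_def F_carrier hom_mult[symmetric] simp del: hom_mult)

lemma frac_in_reps:
  assumes "admissible I s"
  shows "(I, frac I s) \<in> loc_reps R F"
proof -
  note I = admissibleD[OF assms]
  interpret I: ideal I R by (rule F_ideal[OF I(1)])
  have "frac I s \<in> module_homs R (ideal_module R I) (quot_module R T)"
    unfolding module_homs_def
  proof (intro CollectI conjI ballI)
    show "frac I s \<in> carrier (ideal_module R I) \<rightarrow>\<^sub>E carrier (quot_module R T)"
      using I(3) by (auto simp: frac_def ideal_module_def quot_module_def restrict_scalars_def carrier_quot)
    fix x y assume "x \<in> carrier (ideal_module R I)" "y \<in> carrier (ideal_module R I)"
    then have "x \<in> I" "y \<in> I" by (simp_all add: ideal_module_def)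
    then show "frac I s (x \<oplus>\<^bsub>ideal_module R I\<^esub> y) = frac I s x \<oplus>\<^bsub>quot_module R T\<^esub> frac I s y"
      using I(2) I(3,4)[of x] I(3,4)[of y]
      by (simp add: frac_def ideal_module_def quot_module_def restrict_scalars_def fibre_add S.l_distr)
  next
    fix r x assume "r \<in> carrier R" "x \<in> carrier (ideal_module R I)"
    then have "r \<in> carrier R" "x \<in> I" by (simp_all add: ideal_module_def)
    then show "frac I s (r \<odot>\<^bsub>ideal_module R I\<^esub> x) = r \<odot>\<^bsub>quot_module R T\<^esub> frac I s x"
      using I(2) I(3,4)[of x] I.I_l_closed[of x r]
      by (simp add: frac_def ideal_module_def fibre_smult S.m_assoc)
  qed
  then show ?thesis using I(1) by (simp add: loc_reps_def)
qed

text \<open>Regard \<open>f\<close> as a linear map \<open>v\<close> from \<open>I\<close> to \<open>S\<close>. Linearity gives \<open>\<phi> b v(a) = v(a b) = \<phi> a v(b)\<close>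
for \<open>a, b \<in> I\<close>, so \<open>\<phi> b v\<close> is multiplication by \<open>v(b)\<close>. The elements \<open>u\<close> for which \<open>u v\<close>
is multiplication by some element of \<open>S\<close> thus form an ideal containing \<open>\<phi>(I)\<close>, and \<open>u = 1\<close> is
among them.\<close>

lemma reps_are_fracs:
  assumes "(I, f) \<in> loc_reps R F"
  obtains s where "admissible I s" "f = frac I s"
proof -
  have I: "I \<in> F" and f: "f \<in> module_homs R (ideal_module R I) (quot_module R T)"
    using assms by (auto simp: loc_reps_def)
  interpret I: ideal I R by (rule F_ideal[OF I])
  have IR: "a \<in> I \<Longrightarrow> a \<in> carrier R" for a using F_subset[OF I] by blast
  have fE: "f \<in> extensional I"
    using f by (auto simp: module_homs_def ideal_module_def PiE_def)
  have "\<exists>w. w \<in> \<phi> ` carrier R \<and> f a = fibre w" if "a \<in> I" for a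
    using module_homsD(1)[OF f, of a] that
    by (auto simp: ideal_module_def quot_module_def restrict_scalars_def carrier_quot)
  then obtain v where v: "\<And>a. a \<in> I \<Longrightarrow> v a \<in> \<phi> ` carrier R \<and> f a = fibre (v a)"
    by metis
  have vS: "v a \<in> carrier S" if "a \<in> I" for a using v[OF that] by auto
  have v_smult: "v (r \<otimes> a) = \<phi> r \<otimes>\<^bsub>S\<^esub> v a" if r: "r \<in> carrier R" and a: "a \<in> I" for r a
  proof -
    have ra: "r \<otimes> a \<in> I" using I.I_l_closed a r by simp
    have "fibre (v (r \<otimes> a)) = fibre (\<phi> r \<otimes>\<^bsub>S\<^esub> v a)"
      using module_homsD(3)[OF f r, of a] a v[OF a] v[OF ra] r
      by (simp add: ideal_module_def fibre_smult)
    then show ?thesis using fibre_eq_iff v[OF ra] by simp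
  qed
  define U where "U = {u \<in> carrier S. \<exists>s\<in>carrier S. \<forall>a\<in>I. u \<otimes>\<^bsub>S\<^esub> v a = \<phi> a \<otimes>\<^bsub>S\<^esub> s}"
  have "U = carrier S"
  proof (rule ideal_containing_F_member[OF I])
    show "ideal U S"
    proof (rule S.ideal_of_closed)
      show "\<zero>\<^bsub>S\<^esub> \<in> U" using vS IR by (auto simp: U_def intro!: bexI[of _ "\<zero>\<^bsub>S\<^esub>"])
    next
      fix x y assume "x \<in> U" "y \<in> U"
      then obtain s t where "x \<in> carrier S" "y \<in> carrier S" "s \<in> carrier S" "t \<in> carrier S"
        "\<forall>a\<in>I. x \<otimes>\<^bsub>S\<^esub> v a = \<phi> a \<otimes>\<^bsub>S\<^esub> s" "\<forall>a\<in>I. y \<otimes>\<^bsub>S\<^esub> v a = \<phi> a \<otimes>\<^bsub>S\<^esub> t"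
        by (auto simp: U_def)
      then show "x \<oplus>\<^bsub>S\<^esub> y \<in> U" using vS IR
        by (auto simp: U_def S.l_distr S.r_distr intro!: bexI[of _ "s \<oplus>\<^bsub>S\<^esub> t"])
    next
      fix x r assume "x \<in> U" and r: "r \<in> carrier S"
      then obtain s where "x \<in> carrier S" "s \<in> carrier S"
        "\<forall>a\<in>I. x \<otimes>\<^bsub>S\<^esub> v a = \<phi> a \<otimes>\<^bsub>S\<^esub> s"
        by (auto simp: U_def)
      then show "r \<otimes>\<^bsub>S\<^esub> x \<in> U" using vS IR r
        by (auto simp: U_def S.m_assoc S.m_lcomm intro!: bexI[of _ "r \<otimes>\<^bsub>S\<^esub> s"])
    qed (auto simp: U_def)
    show "\<phi> ` I \<subseteq> U"
    proof (rule image_subsetI)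
      fix b assume b: "b \<in> I"
      have "\<phi> b \<otimes>\<^bsub>S\<^esub> v a = \<phi> a \<otimes>\<^bsub>S\<^esub> v b" if a: "a \<in> I" for a
        using v_smult[OF IR[OF b] a] v_smult[OF IR[OF a] b] R.m_comm[OF IR[OF b] IR[OF a]] by simp
      then show "\<phi> b \<in> U" using vS[OF b] IR[OF b] by (auto simp: U_def)
    qed
  qed
  then have "\<one>\<^bsub>S\<^esub> \<in> U" by simp
  then obtain s where s: "s \<in> carrier S" "\<And>a. a \<in> I \<Longrightarrow> v a = \<phi> a \<otimes>\<^bsub>S\<^esub> s"
    using vS by (auto simp: U_def)
  have "admissible I s" unfolding admissible_def using I s v by metis
  moreover have "f = frac I s"
    unfolding frac_def by (rule extensionalityI[OF fE]) (use v s in auto)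
  ultimately show ?thesis by (rule that)
qed

definition frac_class :: "'c \<Rightarrow> ('a set \<times> ('a \<Rightarrow> 'a set)) set"
  where "frac_class s = {(I, frac I s) | I. admissible I s}"

text \<open>A homomorphism, even restricted to a smaller ideal in \<open>F\<close>, remembers its multiplier: fibres over the
image of \<open>\<phi>\<close> are non-empty, so they determine the products \<open>\<phi> a s\<close>, and these determine \<open>s\<close>.\<close>

lemma frac_agree:
  assumes s: "admissible I s" and t: "admissible J t" and K: "K \<in> F" "K \<subseteq> I" "K \<subseteq> J"
    and eq: "restrict (frac I s) K = restrict (frac J t) K"
  shows "s = t"
proof (rule F_cancel[OF K(1)])
  fix a assume a: "a \<in> K"
  then have "fibre (\<phi> a \<otimes>\<^bsub>S\<^esub> s) = fibre (\<phi> a \<otimes>\<^bsub>S\<^esub> t)"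
    using fun_cong[OF eq, of a] K subsetD[of K I a] subsetD[of K J a] by (simp add: frac_def)
  then show "\<phi> a \<otimes>\<^bsub>S\<^esub> s = \<phi> a \<otimes>\<^bsub>S\<^esub> t"
    using fibre_eq_iff admissibleD(3)[OF s] a K by blast
qed (use admissibleD[OF s] admissibleD[OF t] in auto)

text \<open>The classes in the colimit correspond to the elements of \<open>S\<close>, whatever ideals represent them.\<close>

lemma loc_class_frac:
  assumes "admissible I s"
  shows "loc_class R F I (frac I s) = frac_class s"
proof (intro subset_antisym subrelI)
  fix J g assume "(J, g) \<in> loc_class R F I (frac I s)"
  then obtain K where J: "(J, g) \<in> loc_reps R F"
    and K: "K \<in> F" "K \<subseteq> I" "K \<subseteq> J" "restrict (frac I s) K = restrict g K"
    by (auto simp: loc_class_def loc_rel_def)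
  obtain t where t: "admissible J t" "g = frac J t" using reps_are_fracs[OF J] by blast
  then have "s = t" using frac_agree[OF assms t(1) K(1-3)] K(4) by simp
  then show "(J, g) \<in> frac_class s" using t by (auto simp: frac_class_def)
next
  fix J g assume "(J, g) \<in> frac_class s"
  then have J: "admissible J s" "g = frac J s" by (auto simp: frac_class_def)
  have "restrict (frac I s) (I \<inter> J) = restrict (frac J s) (I \<inter> J)"
    by (rule ext) (simp add: frac_def restrict_def)
  then show "(J, g) \<in> loc_class R F I (frac I s)"
    using frac_in_reps[OF assms] frac_in_reps[OF J(1)] J(2)
      F_Int[OF admissibleD(1)[OF assms] admissibleD(1)[OF J(1)]]
    by (auto simp: loc_class_def loc_rel_def)
qed

lemma inj_frac_class: "inj_on frac_class (carrier S)"
proof (rule inj_onI)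
  fix s t assume s: "s \<in> carrier S" and "t \<in> carrier S" and eq: "frac_class s = frac_class t"
  obtain I where I: "admissible I s" using admissible_conductor[OF s] by blast
  then have "(I, frac I s) \<in> frac_class s" by (auto simp: frac_class_def)
  then have "(I, frac I s) \<in> frac_class t" using eq by simp
  then have "admissible I t" "frac I s = frac I t" by (auto simp: frac_class_def)
  then show "s = t" using frac_agree[OF I _ admissibleD(1)[OF I]] by auto
qed

lemma carrier_loc_ring: "carrier (loc_ring R F) = frac_class ` carrier S"
proof -
  have "carrier (loc_ring R F) = (\<lambda>(I, f). loc_class R F I f) ` loc_reps R F"
    by (auto simp: loc_ring_def quotient_def loc_class_def)
  also have "\<dots> = frac_class ` carrier S"
  proof (intro subset_antisym image_subsetI)
    fix x assume "x \<in> loc_reps R F"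
    then show "(case x of (I, f) \<Rightarrow> loc_class R F I f) \<in> frac_class ` carrier S"
      using reps_are_fracs loc_class_frac admissibleD(2) by (cases x) (metis case_prod_conv imageI)
  next
    fix s assume "s \<in> carrier S"
    then have "admissible {a \<in> carrier R. \<phi> a \<otimes>\<^bsub>S\<^esub> s \<in> \<phi> ` carrier R} s" by (rule admissible_conductor)
    from frac_in_reps[OF this] loc_class_frac[OF this]
    show "frac_class s \<in> (\<lambda>(I, f). loc_class R F I f) ` loc_reps R F" by force
  qed
  finally show ?thesis .
qed

lemma Union_over_frac_classes:
  fixes opr :: "_ \<Rightarrow> _ \<Rightarrow> _ \<Rightarrow> _ \<Rightarrow> 'x set"
  assumes "s \<in> carrier S" "t \<in> carrier S"
    and "\<And>I J. admissible I s \<Longrightarrow> admissible J t \<Longrightarrow> opr I (frac I s) J (frac J t) = W"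
  shows "(\<Union>(I, f)\<in>frac_class s. \<Union>(J, g)\<in>frac_class t. opr I f J g) = W"
  using admissible_conductor[OF assms(1)] admissible_conductor[OF assms(2)] assms(3)
  by (fastforce simp: frac_class_def)

lemma frac_class_add:
  assumes "s \<in> carrier S" "t \<in> carrier S"
  shows "frac_class s \<oplus>\<^bsub>loc_ring R F\<^esub> frac_class t = frac_class (s \<oplus>\<^bsub>S\<^esub> t)"
proof -
  have "loc_add_rep R F I (frac I s) J (frac J t) = frac_class (s \<oplus>\<^bsub>S\<^esub> t)"
    if I: "admissible I s" and J: "admissible J t" for I J
  proof -
    have sum: "\<phi> a \<otimes>\<^bsub>S\<^esub> (s \<oplus>\<^bsub>S\<^esub> t) \<in> \<phi> ` carrier R
        \<and> frac I s a \<oplus>\<^bsub>R Quot T\<^esub> frac J t a = fibre (\<phi> a \<otimes>\<^bsub>S\<^esub> (s \<oplus>\<^bsub>S\<^esub> t))" if a: "a \<in> I \<inter> J" for a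
    proof -
      obtain b c where "b \<in> carrier R" "c \<in> carrier R" "\<phi> a \<otimes>\<^bsub>S\<^esub> s = \<phi> b" "\<phi> a \<otimes>\<^bsub>S\<^esub> t = \<phi> c"
        using admissibleD(3)[OF I, of a] admissibleD(3)[OF J, of a] a by auto
      moreover have "\<phi> a \<otimes>\<^bsub>S\<^esub> (s \<oplus>\<^bsub>S\<^esub> t) = \<phi> a \<otimes>\<^bsub>S\<^esub> s \<oplus>\<^bsub>S\<^esub> \<phi> a \<otimes>\<^bsub>S\<^esub> t"
        using admissibleD(4)[OF I, of a] a assms by (simp add: S.r_distr)
      ultimately show ?thesis
        using a by (auto simp: frac_def fibre_add hom_add[symmetric] simp del: hom_add)
    qed
    then have "admissible (I \<inter> J) (s \<oplus>\<^bsub>S\<^esub> t)"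
      using assms F_Int[OF admissibleD(1)[OF I] admissibleD(1)[OF J]] by (simp add: admissible_def)
    moreover have "(\<lambda>a\<in>I \<inter> J. frac I s a \<oplus>\<^bsub>R Quot T\<^esub> frac J t a) = frac (I \<inter> J) (s \<oplus>\<^bsub>S\<^esub> t)"
      unfolding frac_def[of "I \<inter> J"] using sum by (intro restrict_ext) blast
    ultimately show ?thesis unfolding loc_add_rep_def using loc_class_frac by simp
  qed
  then show ?thesis
    using Union_over_frac_classes[OF assms, of "loc_add_rep R F"] by (simp add: loc_ring_def)
qed

lemma ideal_bar_eq:
  assumes "J \<in> F"
  shows "ideal_bar R F J = (\<lambda>b. fibre (\<phi> b)) ` J"
proof -
  note JR = F_subset[OF assms]
  have coset: "T +> (j \<oplus> k) = fibre (\<phi> j)" if j: "j \<in> J" and k: "k \<in> T" for j k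
  proof -
    have "k \<in> carrier R" "\<phi> k = \<zero>\<^bsub>S\<^esub>" "j \<in> carrier R"
      using j k JR unfolding torsion_eq_kernel a_kernel_def' by auto
    then show ?thesis by (simp add: torsion_coset)
  qed
  show ?thesis
  proof (intro subset_antisym subsetI)
    fix A assume "A \<in> ideal_bar R F J"
    then obtain j k where "j \<in> J" "k \<in> T" "A = T +> (j \<oplus> k)"
      by (auto simp: ideal_bar_def set_add_def')
    then show "A \<in> (\<lambda>b. fibre (\<phi> b)) ` J" using coset by simp
  next
    fix A assume "A \<in> (\<lambda>b. fibre (\<phi> b)) ` J"
    then obtain j where j: "j \<in> J" "A = T +> (j \<oplus> \<zero>)" using coset T.zero_closed by auto
    then have "j \<oplus> \<zero> \<in> J <+> T" using T.zero_closed unfolding set_add_def' by blast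
    then show "A \<in> ideal_bar R F J" using j(2) unfolding ideal_bar_def by blast
  qed
qed

text \<open>The definite description denotes something because a coset determines the common image \<open>\<phi> b\<close> of its
elements, and \<open>frac J t b\<close> depends on \<open>b\<close> only through \<open>\<phi> b\<close>.\<close>

lemma hom_bar_frac:
  assumes J: "admissible J t" and b: "b \<in> J"
  shows "hom_bar R F J (frac J t) (fibre (\<phi> b)) = fibre (\<phi> b \<otimes>\<^bsub>S\<^esub> t)"
  unfolding hom_bar_def
proof (rule the_equality)
  show "\<exists>c\<in>J. fibre (\<phi> b) = T +> c \<and> fibre (\<phi> b \<otimes>\<^bsub>S\<^esub> t) = frac J t c"
    using b admissibleD(4)[OF J b] by (intro bexI[of _ b]) (simp_all add: torsion_coset frac_def)
next
  fix B assume "\<exists>c\<in>J. fibre (\<phi> b) = T +> c \<and> B = frac J t c"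
  then obtain c where c: "c \<in> J" "fibre (\<phi> b) = T +> c" "B = frac J t c" by blast
  then have "\<phi> b = \<phi> c"
    using admissibleD(4)[OF J] b fibre_eq_iff[of "\<phi> b" "\<phi> c"] by (simp add: torsion_coset)
  then show "B = fibre (\<phi> b \<otimes>\<^bsub>S\<^esub> t)" using c by (simp add: frac_def)
qed

text \<open>Composing multiplication by \<open>s\<close> with multiplication by \<open>t\<close> is multiplication by \<open>s t\<close>. The domain
\<open>K\<close> of the composite contains all products of an element of \<open>I\<close> and one of \<open>J\<close>, which puts it in
\<open>F\<close>.\<close>

lemma frac_class_mult:
  assumes "s \<in> carrier S" "t \<in> carrier S"
  shows "frac_class s \<otimes>\<^bsub>loc_ring R F\<^esub> frac_class t = frac_class (s \<otimes>\<^bsub>S\<^esub> t)"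
proof -
  have "loc_mult_rep R F I (frac I s) J (frac J t) = frac_class (s \<otimes>\<^bsub>S\<^esub> t)"
    if I: "admissible I s" and J: "admissible J t" for I J
  proof -
    interpret I: ideal I R by (rule F_ideal[OF admissibleD(1)[OF I]])
    interpret J: ideal J R by (rule F_ideal[OF admissibleD(1)[OF J]])
    define K where "K = {x \<in> I. frac I s x \<in> ideal_bar R F J}"
    have K_eq: "K = {x \<in> I. \<phi> x \<otimes>\<^bsub>S\<^esub> s \<in> \<phi> ` J}"
      using fibre_eq_iff[OF admissibleD(3)[OF I]]
      by (auto simp: K_def ideal_bar_eq[OF admissibleD(1)[OF J]] frac_def)
    have "ideal K R"
    proof (rule R.ideal_of_closed)
      show "K \<subseteq> carrier R" using admissibleD(4)[OF I] by (auto simp: K_eq)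
      show "\<zero> \<in> K" using assms J.zero_closed by (auto simp: K_eq image_iff intro!: bexI[of _ \<zero>])
      fix x assume "x \<in> K"
      then obtain b where x: "x \<in> I" "x \<in> carrier R" and b: "b \<in> J" "b \<in> carrier R" "\<phi> x \<otimes>\<^bsub>S\<^esub> s = \<phi> b"
        using admissibleD(4)[OF I] admissibleD(4)[OF J] by (auto simp: K_eq)
      show "r \<otimes> x \<in> K" if "r \<in> carrier R" for r
        using that x b assms I.I_l_closed[of x r] J.I_l_closed[of b r]
        by (auto simp: K_eq image_iff S.m_assoc intro!: bexI[of _ "r \<otimes> b"])
      fix y assume "y \<in> K"
      then obtain c where y: "y \<in> I" "y \<in> carrier R" and c: "c \<in> J" "c \<in> carrier R" "\<phi> y \<otimes>\<^bsub>S\<^esub> s = \<phi> c"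
        using admissibleD(4)[OF I] admissibleD(4)[OF J] by (auto simp: K_eq)
      show "x \<oplus> y \<in> K"
        using x b y c assms by (auto simp: K_eq image_iff S.l_distr intro!: bexI[of _ "b \<oplus> c"])
    qed
    then have "K \<in> F"
    proof (rule F_product[OF admissibleD(1)[OF I] admissibleD(1)[OF J]])
      fix x y assume x: "x \<in> I" and y: "y \<in> J"
      have cl: "x \<in> carrier R" "y \<in> carrier R" using admissibleD(4)[OF I x] admissibleD(4)[OF J y] by auto
      obtain b where b: "b \<in> carrier R" "\<phi> x \<otimes>\<^bsub>S\<^esub> s = \<phi> b" using admissibleD(3)[OF I x] by auto
      have "\<phi> (x \<otimes> y) \<otimes>\<^bsub>S\<^esub> s = \<phi> (b \<otimes> y)"
        using cl b assms by (simp add: S.m_ac flip: b(2))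
      moreover have "b \<otimes> y \<in> J" "x \<otimes> y \<in> I"
        using J.I_l_closed[OF y b(1)] I.I_r_closed[OF x cl(2)] .
      ultimately show "x \<otimes> y \<in> K" by (auto simp: K_eq)
    qed
    have prod: "\<phi> x \<otimes>\<^bsub>S\<^esub> (s \<otimes>\<^bsub>S\<^esub> t) \<in> \<phi> ` carrier R
        \<and> hom_bar R F J (frac J t) (frac I s x) = fibre (\<phi> x \<otimes>\<^bsub>S\<^esub> (s \<otimes>\<^bsub>S\<^esub> t))" if x: "x \<in> K" for x
    proof -
      obtain b where b: "b \<in> J" "\<phi> x \<otimes>\<^bsub>S\<^esub> s = \<phi> b" and xI: "x \<in> I" using x by (auto simp: K_eq)
      have "\<phi> x \<otimes>\<^bsub>S\<^esub> (s \<otimes>\<^bsub>S\<^esub> t) = \<phi> b \<otimes>\<^bsub>S\<^esub> t"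
        using admissibleD(4)[OF I xI] assms by (simp add: S.m_assoc flip: b(2))
      then show ?thesis
        using admissibleD(3)[OF J b(1)] hom_bar_frac[OF J b(1)] xI b(2) by (simp add: frac_def)
    qed
    then have "admissible K (s \<otimes>\<^bsub>S\<^esub> t)" using assms \<open>K \<in> F\<close> by (simp add: admissible_def)
    moreover have "(\<lambda>x\<in>K. hom_bar R F J (frac J t) (frac I s x)) = frac K (s \<otimes>\<^bsub>S\<^esub> t)"
      unfolding frac_def[of K] using prod by (intro restrict_ext) blast
    ultimately show ?thesis
      unfolding loc_mult_rep_def Let_def K_def[symmetric] using loc_class_frac by simp
  qed
  then show ?thesis
    using Union_over_frac_classes[OF assms, of "loc_mult_rep R F"] by (simp add: loc_ring_def)
qed

lemma loc_map_eq: "r \<in> carrier R \<Longrightarrow> loc_map R F r = frac_class (\<phi> r)"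
proof -
  assume r: "r \<in> carrier R"
  have "(\<lambda>a\<in>carrier R. T +> (a \<otimes> r)) = frac (carrier R) (\<phi> r)"
    unfolding frac_def using r by (intro restrict_ext) (simp add: torsion_coset)
  then show ?thesis unfolding loc_map_def using loc_class_frac[OF admissible_image[OF r]] by simp
qed

lemma frac_class_one: "frac_class \<one>\<^bsub>S\<^esub> = \<one>\<^bsub>loc_ring R F\<^esub>"
proof -
  have "(\<lambda>a\<in>carrier R. T +> a) = frac (carrier R) (\<phi> \<one>)"
    unfolding frac_def by (intro restrict_ext) (simp add: torsion_coset)
  then show ?thesis using loc_class_frac[OF admissible_image[OF R.one_closed]] by (simp add: loc_ring_def)
qed

text \<open>For uniqueness, apply a competitor \<open>\<theta>\<close> to \<open>frac_class (\<phi> a) frac_class s = frac_class (\<phi> a s)\<close>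
with \<open>a\<close> in the conductor of \<open>s\<close>. Since \<open>\<phi> a\<close> and \<open>\<phi> a s\<close> are both in the image of \<open>\<phi>\<close>, where
\<open>\<theta>\<close> is prescribed, \<open>\<phi> a \<theta>(frac_class s) = \<phi> a s\<close>, and these \<open>\<phi> a\<close> can be cancelled.\<close>

lemma unique_loc_ring_iso:
  "\<exists>!\<psi>. \<psi> \<in> ring_iso (loc_ring R F) S \<and> \<psi> \<in> extensional (carrier (loc_ring R F)) \<and>
     (\<forall>r\<in>carrier R. \<phi> r = \<psi> (loc_map R F r))"
proof (rule ex1I)
  let ?L = "loc_ring R F"
  define \<psi> where "\<psi> = restrict (inv_into (carrier S) frac_class) (carrier ?L)"
  have \<psi>: "\<psi> (frac_class s) = s" if "s \<in> carrier S" for s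
    using that inj_frac_class by (simp add: \<psi>_def carrier_loc_ring)
  have "\<psi> \<in> ring_hom ?L S"
    by (rule ring_hom_memI)
      (auto simp: carrier_loc_ring \<psi> frac_class_add frac_class_mult simp flip: frac_class_one)
  moreover have "bij_betw \<psi> (carrier ?L) (carrier S)"
    by (rule bij_betw_byWitness[where f' = frac_class]) (auto simp: carrier_loc_ring \<psi>)
  ultimately show "\<psi> \<in> ring_iso ?L S \<and> \<psi> \<in> extensional (carrier ?L) \<and>
      (\<forall>r\<in>carrier R. \<phi> r = \<psi> (loc_map R F r))"
    by (auto simp: ring_iso_def loc_map_eq \<psi>) (simp add: \<psi>_def)
  fix \<theta> assume \<theta>: "\<theta> \<in> ring_iso ?L S \<and> \<theta> \<in> extensional (carrier ?L) \<and>
      (\<forall>r\<in>carrier R. \<phi> r = \<theta> (loc_map R F r))"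
  then have hom: "\<theta> \<in> ring_hom ?L S" by (simp add: ring_iso_def)
  have \<theta>\<phi>: "\<theta> (frac_class (\<phi> r)) = \<phi> r" if "r \<in> carrier R" for r
    using \<theta> that by (simp add: loc_map_eq)
  have "\<theta> (frac_class s) = s" if s: "s \<in> carrier S" for s
  proof (rule F_cancel[OF conductor_in_F[OF s] _ s])
    show "\<theta> (frac_class s) \<in> carrier S"
      using ring_hom_closed[OF hom] s by (simp add: carrier_loc_ring)
    fix a assume "a \<in> {a \<in> carrier R. \<phi> a \<otimes>\<^bsub>S\<^esub> s \<in> \<phi> ` carrier R}"
    then obtain b where a: "a \<in> carrier R" and b: "b \<in> carrier R" "\<phi> a \<otimes>\<^bsub>S\<^esub> s = \<phi> b" by auto
    have "\<phi> a \<otimes>\<^bsub>S\<^esub> \<theta> (frac_class s) = \<theta> (frac_class (\<phi> a) \<otimes>\<^bsub>?L\<^esub> frac_class s)"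
      using ring_hom_mult[OF hom, of "frac_class (\<phi> a)" "frac_class s"] a s
      by (simp add: carrier_loc_ring \<theta>\<phi>)
    also have "\<dots> = \<phi> a \<otimes>\<^bsub>S\<^esub> s"
      using a s b by (simp add: frac_class_mult \<theta>\<phi>)
    finally show "\<phi> a \<otimes>\<^bsub>S\<^esub> \<theta> (frac_class s) = \<phi> a \<otimes>\<^bsub>S\<^esub> s" .
  qed
  then show "\<theta> = \<psi>"
    using \<theta> \<psi> by (intro extensionalityI[of _ "carrier ?L"]) (auto simp: carrier_loc_ring \<psi>_def)
qed

end

section \<open>Flat epimorphisms as rings of fractions\<close>

theorem corollary3p3:
  fixes R :: "('a, 'c) ring_scheme" and S :: "('b, 'd) ring_scheme"
    and \<phi> :: "'a \<Rightarrow> 'b" and F :: "'a set set"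
  assumes "cring R" and "cring S" and "\<phi> \<in> ring_hom R S"
    and "F = {I. ideal I R \<and> Idl\<^bsub>S\<^esub> (\<phi> ` I) = carrier S}"
    and "flat_ring_hom TYPE('a + 'b) R S \<phi>"
    and "comm_ring_epi TYPE(('b \<times> 'b \<Rightarrow>\<^sub>0 int) set) R S \<phi>"
  shows "\<exists>!\<psi>. \<psi> \<in> ring_iso (loc_ring R F) S \<and> \<psi> \<in> extensional (carrier (loc_ring R F)) \<and>
           (\<forall>r\<in>carrier R. \<phi> r = \<psi> (loc_map R F r))"
proof -
  interpret H: ring_hom_cring R S \<phi>
    by (intro ring_hom_cring.intro ring_hom_cring_axioms.intro assms)
  let ?RR = "restrict_scalars id R" and ?Q = "restrict_scalars \<phi> S"
  have RR: "module R ?RR"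
    by (rule module_restrict_scalars) (auto intro: assms ring_hom_memI)
  have Q: "module R ?Q"
    by (rule module_restrict_scalars) fact+
  interpret RR: module R ?RR by fact
  interpret Q: module R ?Q by fact
  have "ideal_localization R S \<phi> F"
  proof (intro ideal_localization.intro ideal_localization_axioms.intro)
    fix r assume r: "r \<in> carrier R" "\<phi> r = \<zero>\<^bsub>S\<^esub>"
    have sub: "submodule {\<zero>\<^bsub>R\<^esub>} R ?RR"
      by (intro RR.submodule_of_closed) (auto simp: restrict_scalars_def)
    \<comment> \<open>\<open>r \<otimes> 1 = 1 \<otimes> \<phi> r = 1 \<otimes> 0 = 0 \<otimes> 1\<close>.\<close>
    have "frag_of (r \<odot>\<^bsub>?RR\<^esub> \<one>\<^bsub>R\<^esub>, \<one>\<^bsub>S\<^esub>) - frag_of (\<one>\<^bsub>R\<^esub>, r \<odot>\<^bsub>?Q\<^esub> \<one>\<^bsub>S\<^esub>) \<in> tensor_kernel R ?RR ?Q"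
      using r(1) by (intro subsetD[OF tensor_relations_subset_kernel] tensor_relation_smult)
        (auto simp: restrict_scalars_def)
    moreover have "frag_of (\<zero>\<^bsub>R\<^esub> \<odot>\<^bsub>?RR\<^esub> \<one>\<^bsub>R\<^esub>, \<one>\<^bsub>S\<^esub>) - frag_of (\<one>\<^bsub>R\<^esub>, \<zero>\<^bsub>R\<^esub> \<odot>\<^bsub>?Q\<^esub> \<one>\<^bsub>S\<^esub>) \<in> tensor_kernel R ?RR ?Q"
      by (intro subsetD[OF tensor_relations_subset_kernel] tensor_relation_smult)
        (auto simp: restrict_scalars_def)
    ultimately have "frag_of (r, \<one>\<^bsub>S\<^esub>) - frag_of (\<zero>\<^bsub>R\<^esub>, \<one>\<^bsub>S\<^esub>) \<in> tensor_kernel R ?RR ?Q"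
      using r tensor_kernel_diff[OF RR Q] by (fastforce simp: restrict_scalars_def)
    then have "Idl\<^bsub>S\<^esub> (\<phi> ` {a \<in> carrier R. a \<odot>\<^bsub>?RR\<^esub> r \<in> {\<zero>\<^bsub>R\<^esub>}}) = carrier S"
      using r sub by (intro flat_conductor_generates_inj[where e = Inl, OF assms(1,2,5) _ RR])
        (auto simp: restrict_scalars_def)
    moreover have "ideal {a \<in> carrier R. a \<odot>\<^bsub>?RR\<^esub> r \<in> {\<zero>\<^bsub>R\<^esub>}} R"
      using RR.ideal_conductor[OF sub, of r] r by (simp add: restrict_scalars_def)
    moreover have "{a \<in> carrier R. a \<odot>\<^bsub>?RR\<^esub> r \<in> {\<zero>\<^bsub>R\<^esub>}} = annihilator R r"
      by (auto simp: annihilator_def restrict_scalars_def)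
    ultimately show "annihilator R r \<in> F" using assms(4) by simp
  next
    fix s assume s: "s \<in> carrier S"
    have P: "submodule (\<phi> ` carrier R) R ?Q"
    proof (rule Q.submodule_of_closed)
      show "\<zero>\<^bsub>?Q\<^esub> \<in> \<phi> ` carrier R"
        using H.hom_zero by (auto simp: restrict_scalars_def image_iff intro!: bexI[of _ "\<zero>\<^bsub>R\<^esub>"])
    qed (auto simp: restrict_scalars_def simp flip: H.hom_add H.hom_mult)
    have "frag_of (s, \<one>\<^bsub>S\<^esub>) - frag_of (\<one>\<^bsub>S\<^esub>, s) \<in> tensor_kernel R ?Q ?Q"
      by (rule epi_imp_tensor_symmetric[OF assms(1,2,6) s])
    moreover have "\<one>\<^bsub>S\<^esub> \<in> \<phi> ` carrier R" using H.hom_one by (metis H.R.one_closed imageI)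
    ultimately have "Idl\<^bsub>S\<^esub> (\<phi> ` {a \<in> carrier R. a \<odot>\<^bsub>?Q\<^esub> s \<in> \<phi> ` carrier R}) = carrier S"
      using s P by (intro flat_conductor_generates_inj[where e = Inr, OF assms(1,2,5) _ Q])
        (auto simp: restrict_scalars_def)
    moreover have "ideal {a \<in> carrier R. a \<odot>\<^bsub>?Q\<^esub> s \<in> \<phi> ` carrier R} R"
      using Q.ideal_conductor[OF P, of s] s by (simp add: restrict_scalars_def)
    ultimately show "{a \<in> carrier R. \<phi> a \<otimes>\<^bsub>S\<^esub> s \<in> \<phi> ` carrier R} \<in> F"
      using assms(4) by (simp add: restrict_scalars_def)
  qed (use assms H.ring_hom_cring_axioms in auto)
  then show ?thesis by (rule ideal_localization.unique_loc_ring_iso)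
qed

end
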